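(* For each $n \geq 1$ let $\mathcal{A}_n$ be uniformly distributed on $\mathcal{M}(n,2)$. Then $$S_n := \inf\{k \geq 1 : \chi_k(\mathcal{A}_n) > 0\} \stackrel{d}{\longrightarrow} S_\infty \quad \text{as } n\to\infty,$$ where $S_\infty$ is a random variable with $$\mathbb{P}(S_\infty = r) = \begin{cases} 1 - e^{-1}, & \text{if } r = 1, \\ \exp\left(-\dfrac{1}{2} - \dfrac{H_{r-1}}{2}\right)\left(1 - e^{-1/(2r)}\right), & \text{if } r > 1, \end{cases}$$ for $r \in \mathbb{N}$, with $H_r := \sum_{k=1}^r k^{-1}$ for all $r \geq 1$.
   Context: For $n \geq 1$, $\mathcal{M}(n,2)$ is the (finite) set of $n \times n$ matrices $A = (a_{ij})$ with non-negative integer entries all of whose row sums and column sums equal $2$. Each $A \in \mathcal{M}(n,2)$ is identified with the labelled $2$-regular bipartite multigraph $G_A$ on vertices $\{R_1,\ldots,R_n\} \cup \{C_1,\ldots,C_n\}$ having exactly $a_{ij}$ edges between $R_i$ and $C_j$. A $k$-component of $A$ is a pair $(S,T)$ of non-empty subsets of $\{1,\ldots,n\}$ with $|S| = |T| = k$ such that the submatrix $(a_{ij})_{i\in S, j \in T}$ has all row and column sums equal to $2$. A component is irreducible if no other component $(S',T') \neq (S,T)$ satisfies $S' \subseteq S$, $T' \subseteq T$. $\chi_k(A)$ denotes the number of irreducible $k$-components of $A$, equivalently the number of connected components of $G_A$ having exactly $2k$ vertices; $\chi_k(A) = 0$ for $k > n$. *)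

theory Defs
  imports "HOL-Probability.Probability" "HOL-Analysis.Harmonic_Numbers"
begin

text \<open>
  An \<open>n \<times> n\<close> matrix is a function of a row index and a column index, both ranging over
  \<open>{1..n}\<close>. The entries outside \<open>{1..n} \<times> {1..n}\<close> are fixed to \<open>0\<close>, so that a function
  represents exactly one matrix and \<open>matrices2 n\<close> is a finite set.
\<close>

type_synonym nmat = "nat \<Rightarrow> nat \<Rightarrow> nat"

definition matrices2 :: "nat \<Rightarrow> nmat set" where
  "matrices2 n = {A.
     (\<forall>i j. i \<notin> {1..n} \<or> j \<notin> {1..n} \<longrightarrow> A i j = 0) \<and>
     (\<forall>i\<in>{1..n}. (\<Sum>j\<in>{1..n}. A i j) = 2) \<and>
     (\<forall>j\<in>{1..n}. (\<Sum>i\<in>{1..n}. A i j) = 2)}"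

definition is_k_component :: "nat \<Rightarrow> nmat \<Rightarrow> nat \<Rightarrow> nat set \<times> nat set \<Rightarrow> bool" where
  "is_k_component n A k = (\<lambda>(S, T).
     S \<noteq> {} \<and> T \<noteq> {} \<and> S \<subseteq> {1..n} \<and> T \<subseteq> {1..n} \<and> card S = k \<and> card T = k \<and>
     (\<forall>i\<in>S. (\<Sum>j\<in>T. A i j) = 2) \<and> (\<forall>j\<in>T. (\<Sum>i\<in>S. A i j) = 2))"

definition is_component :: "nat \<Rightarrow> nmat \<Rightarrow> nat set \<times> nat set \<Rightarrow> bool" where
  "is_component n A C \<longleftrightarrow> (\<exists>k. is_k_component n A k C)"

definition irreducible_k_component :: "nat \<Rightarrow> nmat \<Rightarrow> nat \<Rightarrow> nat set \<times> nat set \<Rightarrow> bool" where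
  "irreducible_k_component n A k C \<longleftrightarrow> is_k_component n A k C \<and>
     \<not> (\<exists>C'. is_component n A C' \<and> C' \<noteq> C \<and> fst C' \<subseteq> fst C \<and> snd C' \<subseteq> snd C)"

definition num_irreducible :: "nat \<Rightarrow> nat \<Rightarrow> nmat \<Rightarrow> nat" where
  "num_irreducible n k A = card {C. irreducible_k_component n A k C}"

text \<open>
  The infimum is over a non-empty set whenever \<open>n \<ge> 1\<close>, see \<open>ex_irreducible\<close> below, so the
  convention for \<open>Inf {}\<close> on \<^typ>\<open>nat\<close> plays no role.
\<close>

definition smallest_component :: "nat \<Rightarrow> nmat \<Rightarrow> nat" where
  "smallest_component n A = Inf {k. k \<ge> 1 \<and> num_irreducible n k A > 0}"

text \<open>\<open>pmf_of_set\<close> is the uniform distribution only on finite non-empty sets.\<close>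

lemma finite_matrices2: "finite (matrices2 n)"
proof -
  let ?B = "{f. \<forall>p. (p \<in> {1..n} \<times> {1..n} \<longrightarrow> f p \<in> {..2::nat}) \<and> (p \<notin> {1..n} \<times> {1..n} \<longrightarrow> f p = 0)}"
  have "finite ?B"
    by (rule finite_set_of_finite_funs) auto
  moreover have "matrices2 n \<subseteq> curry ` ?B"
  proof
    fix A assume A: "A \<in> matrices2 n"
    have le: "A i j \<le> 2" if "i \<in> {1..n}" "j \<in> {1..n}" for i j
    proof -
      have "A i j \<le> (\<Sum>j\<in>{1..n}. A i j)"
        using that by (intro member_le_sum) auto
      then show ?thesis using A that by (auto simp: matrices2_def)
    qed
    have "case_prod A \<in> ?B"
      using le A by (auto simp: matrices2_def)
    moreover have "A = curry (case_prod A)" by simp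
    ultimately show "A \<in> curry ` ?B" by blast
  qed
  ultimately show ?thesis by (meson finite_imageI finite_subset)
qed

lemma matrices2_nonempty: "matrices2 n \<noteq> {}"
proof -
  have "(\<lambda>i j. if i = j \<and> i \<in> {1..n} then 2 else 0) \<in> matrices2 n"
    by (auto simp: matrices2_def sum.delta if_distrib cong: if_cong)
  then show ?thesis by blast
qed

lemma ex_irreducible:
  assumes "n \<ge> 1" "A \<in> matrices2 n"
  shows "\<exists>k\<ge>1. num_irreducible n k A > 0"
proof -
  have comp: "is_component n A ({1..n}, {1..n})"
    using assms by (auto simp: is_component_def is_k_component_def matrices2_def)
  define m where "m = (\<lambda>C::nat set \<times> nat set. card (fst C) + card (snd C))"
  obtain C where C: "is_component n A C"
    and min: "\<And>C'. is_component n A C' \<Longrightarrow> m C \<le> m C'"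
    using ex_has_least_nat[of "is_component n A", OF comp, of m] by blast
  obtain S T where ST: "C = (S, T)" by (cases C)
  obtain k where k: "is_k_component n A k C" using C by (auto simp: is_component_def)
  have fin: "finite S" "finite T"
    using k ST by (auto simp: is_k_component_def intro: finite_subset)
  have "irreducible_k_component n A k C"
    unfolding irreducible_k_component_def
  proof (intro conjI k notI)
    assume "\<exists>C'. is_component n A C' \<and> C' \<noteq> C \<and> fst C' \<subseteq> fst C \<and> snd C' \<subseteq> snd C"
    then obtain S' T' where C': "is_component n A (S', T')" "(S', T') \<noteq> C" "S' \<subseteq> S" "T' \<subseteq> T"
      using ST by auto
    have "card S + card T \<le> card S' + card T'"
      using min[OF C'(1)] ST by (simp add: m_def)
    moreover have "card S' \<le> card S" "card T' \<le> card T"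
      using C' fin by (auto intro: card_mono)
    ultimately have "card S' = card S" "card T' = card T" by linarith+
    then have "S' = S" "T' = T"
      using C' fin by (simp_all add: card_subset_eq)
    then show False using C' ST by simp
  qed
  moreover have "finite {C. irreducible_k_component n A k C}"
    by (rule finite_subset[of _ "Pow {1..n} \<times> Pow {1..n}"])
       (auto simp: irreducible_k_component_def is_k_component_def)
  ultimately have "num_irreducible n k A > 0"
    unfolding num_irreducible_def by (subst card_gt_0_iff) blast
  moreover have "k \<ge> 1"
    using k fin ST by (auto simp: is_k_component_def Suc_le_eq card_gt_0_iff)
  ultimately show ?thesis by blast
qed

end

theory Submission
  imports Defs "HOL-Complex_Analysis.Laurent_Convergence" "HOL-Real_Asymp.Real_Asymp"
begin

text \<open>
  The smallest component exceeds \<open>r\<close> exactly when every component has more than \<open>r\<close> rows, so the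
  theorem is about the proportion of such matrices. Splitting off the irreducible component of a row
  shows that their number \<open>a n\<close> satisfies the exponential formula
  \<open>(\<Sum>n. a n / (n!)\<^sup>2 * x ^ n) = exp (\<Sum>k>r. c k * x ^ k)\<close>, where \<open>c k * (k!)\<^sup>2\<close> is the number of irreducible
  matrices of size \<open>k\<close> (\<open>sum_large2_recurrence\<close>, \<open>card_large2\<close>).

  The numbers \<open>c k\<close> are obtained from sums of two permutation matrices. Every irreducible
  matrix is such a sum, for exactly two ordered pairs of summands if \<open>k \<ge> 2\<close> and for one if \<open>k = 1\<close>
  (\<open>card_factors_irreducible\<close>). There are \<open>(n!)\<^sup>2\<close> ordered pairs of permutation matrices of
  size \<open>n\<close>, and \<open>(\<Sum>n. x ^ n) = 1 / (1 - x) = exp (\<Sum>k\<ge>1. x ^ k / k)\<close>, so the pairs with irreducible sum number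
  \<open>(k!)\<^sup>2 / k\<close>. Hence \<open>c 1 = 1\<close> and \<open>c k = 1 / (2 * k)\<close> for \<open>k \<ge> 2\<close> (\<open>card_irreducible2\<close>).

  The generating function is therefore \<open>exp (Q x) / sqrt (1 - x)\<close> with a polynomial \<open>Q\<close>, where \<open>Q 1 = 1 / 2\<close>
  for \<open>r = 0\<close> and \<open>Q 1 = - H\<^sub>r / 2\<close> for \<open>r \<ge> 1\<close>. The factor \<open>exp (Q x)\<close> is entire, so the
  coefficients are asymptotic to \<open>exp (Q 1)\<close> times those of \<open>1 / sqrt (1 - x)\<close>
  (\<open>convolution_half_binomial_asymptotics\<close>). Dividing by the case \<open>r = 0\<close>, which counts all matrices, yields the
  limit \<open>exp (- 1 / 2 - H\<^sub>r / 2)\<close> for the probability that the smallest component exceeds \<open>r \<ge> 1\<close>. Convergence of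
  these tail probabilities is convergence of the distribution functions, and since \<open>H\<^sub>r\<close> diverges no mass escapes to infinity.
\<close>

section \<open>Matrices with constant line sums and their components\<close>

definition regular :: "nat \<Rightarrow> nat set \<Rightarrow> nat set \<Rightarrow> nmat set" where
  "regular d S T = {A.
     (\<forall>i j. i \<notin> S \<or> j \<notin> T \<longrightarrow> A i j = 0) \<and>
     (\<forall>i\<in>S. (\<Sum>j\<in>T. A i j) = d) \<and> (\<forall>j\<in>T. (\<Sum>i\<in>S. A i j) = d)}"

text \<open>
  No edge of the bipartite multigraph of \<open>A\<close> joins \<open>U \<union> V\<close> to its complement. In this
  form components are visibly stable under intersection and difference, which is awkward to see from
  the condition that the block on \<open>U \<times> V\<close> has line sums \<open>2\<close>.
\<close>

definition closed_pair :: "nmat \<Rightarrow> nat set \<Rightarrow> nat set \<Rightarrow> bool" where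
  "closed_pair A U V \<longleftrightarrow> (\<forall>i j. A i j \<noteq> 0 \<longrightarrow> (i \<in> U \<longleftrightarrow> j \<in> V))"

definition component :: "nat set \<Rightarrow> nat set \<Rightarrow> nmat \<Rightarrow> nat set \<Rightarrow> nat set \<Rightarrow> bool" where
  "component S T A U V \<longleftrightarrow> U \<subseteq> S \<and> V \<subseteq> T \<and> U \<noteq> {} \<and> closed_pair A U V"

text \<open>
  It suffices to constrain the row set: when all line sums are \<open>2\<close>, the rows of a component
  determine its columns as the positions of their nonzero entries.
\<close>

definition irreducible2 :: "nat set \<Rightarrow> nat set \<Rightarrow> nmat set" where
  "irreducible2 S T = {A \<in> regular 2 S T. S \<noteq> {} \<and> (\<forall>U V. component S T A U V \<longrightarrow> U = S)}"

definition large2 :: "nat \<Rightarrow> nat set \<Rightarrow> nat set \<Rightarrow> nmat set" where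
  "large2 r S T = {A \<in> regular 2 S T. \<forall>U V. component S T A U V \<longrightarrow> r < card U}"

definition restrict_mat :: "nmat \<Rightarrow> nat set \<Rightarrow> nat set \<Rightarrow> nmat" where
  "restrict_mat A U V = (\<lambda>i j. if i \<in> U \<and> j \<in> V then A i j else 0)"

lemma regular_zero: "A \<in> regular d S T \<Longrightarrow> i \<notin> S \<or> j \<notin> T \<Longrightarrow> A i j = 0"
  by (auto simp: regular_def)

lemma regular_pos:
  assumes "A \<in> regular d S T" "0 < A i j"
  shows "i \<in> S" "j \<in> T"
  using assms regular_zero[OF assms(1), of i j] by auto

lemma regular_row: "A \<in> regular d S T \<Longrightarrow> i \<in> S \<Longrightarrow> (\<Sum>j\<in>T. A i j) = d"
  by (auto simp: regular_def)

lemma regular_col: "A \<in> regular d S T \<Longrightarrow> j \<in> T \<Longrightarrow> (\<Sum>i\<in>S. A i j) = d"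
  by (auto simp: regular_def)

lemma regular_entry_le:
  assumes "A \<in> regular d S T" "finite T"
  shows "A i j \<le> d"
proof (cases "i \<in> S \<and> j \<in> T")
  case True
  then have "A i j \<le> (\<Sum>j\<in>T. A i j)"
    using assms by (intro member_le_sum) auto
  then show ?thesis using assms True by (simp add: regular_row)
qed (use assms in \<open>auto simp: regular_zero\<close>)

lemma finite_regular [simp]:
  assumes "finite S" "finite T"
  shows "finite (regular d S T)"
proof -
  let ?B = "{f. \<forall>p. (p \<in> S \<times> T \<longrightarrow> f p \<in> {..d}) \<and> (p \<notin> S \<times> T \<longrightarrow> f p = 0)}"
  have "finite ?B"
    using assms by (intro finite_set_of_finite_funs) auto
  moreover have "regular d S T \<subseteq> curry ` ?B"
  proof
    fix A assume "A \<in> regular d S T"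
    then have "case_prod A \<in> ?B"
      using assms by (auto simp: regular_entry_le regular_zero)
    moreover have "A = curry (case_prod A)" by simp
    ultimately show "A \<in> curry ` ?B" by blast
  qed
  ultimately show ?thesis by (meson finite_imageI finite_subset)
qed

lemma finite_large2 [simp]: "finite S \<Longrightarrow> finite T \<Longrightarrow> finite (large2 r S T)"
  by (simp add: large2_def)

lemma finite_irreducible2 [simp]: "finite S \<Longrightarrow> finite T \<Longrightarrow> finite (irreducible2 S T)"
  by (simp add: irreducible2_def)

lemma regular_card_eq:
  assumes "A \<in> regular d S T" "d > 0"
  shows "card S = card T"
proof -
  have "card S * d = (\<Sum>i\<in>S. \<Sum>j\<in>T. A i j)"
    using assms by (simp add: regular_row)
  also have "\<dots> = (\<Sum>j\<in>T. \<Sum>i\<in>S. A i j)"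
    by (rule sum.swap)
  also have "\<dots> = card T * d"
    using assms by (simp add: regular_col)
  finally show ?thesis using assms by simp
qed

lemma regular_row_nonzero:
  assumes "A \<in> regular d S T" "d > 0" "i \<in> S"
  obtains j where "j \<in> T" "A i j \<noteq> 0"
proof -
  have "(\<Sum>j\<in>T. A i j) \<noteq> 0" using assms by (simp add: regular_row)
  then show ?thesis using that by (meson sum.neutral)
qed

lemma regular_col_nonzero:
  assumes "A \<in> regular d S T" "d > 0" "j \<in> T"
  obtains i where "i \<in> S" "A i j \<noteq> 0"
proof -
  have "(\<Sum>i\<in>S. A i j) \<noteq> 0" using assms by (simp add: regular_col)
  then show ?thesis using that by (meson sum.neutral)
qed

lemma closed_pair_Diff:
  assumes "A \<in> regular d S T" "closed_pair A U V"
  shows "closed_pair A (S - U) (T - V)"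
  using assms unfolding closed_pair_def by (auto dest: regular_pos)

lemma restrict_mat_regular:
  assumes "A \<in> regular d S T" "closed_pair A U V" "U \<subseteq> S" "V \<subseteq> T" "finite S" "finite T"
  shows "restrict_mat A U V \<in> regular d U V"
proof -
  have "(\<Sum>j\<in>V. A i j) = d" if "i \<in> U" for i
  proof -
    have "(\<Sum>j\<in>V. A i j) = (\<Sum>j\<in>T. A i j)"
      using assms that by (intro sum.mono_neutral_left) (auto simp: closed_pair_def)
    then show ?thesis using assms that by (auto simp: regular_row)
  qed
  moreover have "(\<Sum>i\<in>U. A i j) = d" if "j \<in> V" for j
  proof -
    have "(\<Sum>i\<in>U. A i j) = (\<Sum>i\<in>S. A i j)"
      using assms that by (intro sum.mono_neutral_left) (auto simp: closed_pair_def)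
    then show ?thesis using assms that by (auto simp: regular_col)
  qed
  ultimately show ?thesis
    by (simp add: regular_def restrict_mat_def cong: sum.cong)
qed

lemma restrict_mat_split:
  assumes "A \<in> regular d S T" "closed_pair A U V" "U \<subseteq> S" "V \<subseteq> T"
  shows "(\<lambda>i j. restrict_mat A U V i j + restrict_mat A (S - U) (T - V) i j) = A"
proof (intro ext)
  fix i j
  show "restrict_mat A U V i j + restrict_mat A (S - U) (T - V) i j = A i j"
    using assms by (cases "A i j = 0") (auto simp: restrict_mat_def closed_pair_def dest: regular_pos)
qed

lemma regular_direct_sum:
  assumes A: "A \<in> regular d U V" and B: "B \<in> regular d (S - U) (T - V)"
    and sub: "U \<subseteq> S" "V \<subseteq> T" and fin: "finite S" "finite T"
  shows "(\<lambda>i j. A i j + B i j) \<in> regular d S T"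
proof -
  have row: "(\<Sum>j\<in>T. A i j + B i j) = d" if "i \<in> S" for i
  proof -
    have "(\<Sum>j\<in>T. A i j) = (\<Sum>j\<in>V. A i j)" "(\<Sum>j\<in>T. B i j) = (\<Sum>j\<in>T - V. B i j)"
      using sub fin A B by (intro sum.mono_neutral_right; auto simp: regular_zero)+
    moreover have "(\<Sum>j\<in>V. A i j) = (if i \<in> U then d else 0)"
      using A by (auto simp: regular_row regular_zero)
    moreover have "(\<Sum>j\<in>T-V. B i j) = (if i \<in> U then 0 else d)"
      using B that by (auto simp: regular_row regular_zero)
    ultimately show ?thesis by (auto simp: sum.distrib)
  qed
  have col: "(\<Sum>i\<in>S. A i j + B i j) = d" if "j \<in> T" for j
  proof -
    have "(\<Sum>i\<in>S. A i j) = (\<Sum>i\<in>U. A i j)" "(\<Sum>i\<in>S. B i j) = (\<Sum>i\<in>S - U. B i j)"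
      using sub fin A B by (intro sum.mono_neutral_right; auto simp: regular_zero)+
    moreover have "(\<Sum>i\<in>U. A i j) = (if j \<in> V then d else 0)"
      using A by (auto simp: regular_col regular_zero)
    moreover have "(\<Sum>i\<in>S-U. B i j) = (if j \<in> V then 0 else d)"
      using B that by (auto simp: regular_col regular_zero)
    ultimately show ?thesis by (auto simp: sum.distrib)
  qed
  have "A i j + B i j = 0" if "i \<notin> S \<or> j \<notin> T" for i j
    using A B sub that by (auto simp: regular_def)
  with row col show ?thesis by (simp add: regular_def)
qed

lemma closed_pair_direct_sum:
  assumes "A \<in> regular d U V" "B \<in> regular d (S - U) (T - V)"
  shows "closed_pair (\<lambda>i j. A i j + B i j) U V"
  unfolding closed_pair_def
proof (intro allI impI)
  fix i j assume "A i j + B i j \<noteq> 0"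
  then consider "A i j \<noteq> 0" | "B i j \<noteq> 0" by auto
  then show "i \<in> U \<longleftrightarrow> j \<in> V"
    using assms by cases (auto dest: regular_pos)
qed

lemma component_restrict_mat:
  assumes "component U V (restrict_mat A U V) U' V'" "closed_pair A U V" "U \<subseteq> S" "V \<subseteq> T"
  shows "component S T A U' V'"
proof -
  have "i \<in> U' \<longleftrightarrow> j \<in> V'" if "A i j \<noteq> 0" for i j
  proof (cases "i \<in> U")
    case True
    then have "restrict_mat A U V i j \<noteq> 0"
      using that assms(2) by (simp add: restrict_mat_def closed_pair_def)
    then show ?thesis using assms(1) unfolding component_def closed_pair_def by blast
  next
    case False
    then have "j \<notin> V" using that assms(2) unfolding closed_pair_def by blast
    then show ?thesis using False assms(1) unfolding component_def by blast
  qed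
  then show ?thesis using assms unfolding component_def closed_pair_def by blast
qed

lemma component_Diff:
  assumes "component S T A U V" "component S T A U' V'" "\<not> U \<subseteq> U'"
  shows "component S T A (U - U') (V - V')"
  using assms unfolding component_def closed_pair_def by blast

section \<open>Splitting off the irreducible component of a row\<close>

text \<open>
  An irreducible block is connected, so a closed pair that touches one of its rows contains all of
  it: otherwise the intersection would be a smaller component.
\<close>

lemma component_irreducible_subset:
  assumes A: "A \<in> irreducible2 U V" and C: "closed_pair A U' V'" and i: "i \<in> U" "i \<in> U'"
  shows "U \<subseteq> U'" and "V \<subseteq> V'"
proof -
  have reg: "A \<in> regular 2 U V" using A by (simp add: irreducible2_def)
  have "component U V A (U \<inter> U') (V \<inter> V')"
    using i C reg by (auto simp: component_def closed_pair_def dest: regular_pos)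
  then show U: "U \<subseteq> U'" using A by (auto simp: irreducible2_def)
  show "V \<subseteq> V'"
  proof
    fix j assume "j \<in> V"
    with reg obtain i where "i \<in> U" "A i j \<noteq> 0"
      by (auto elim: regular_col_nonzero)
    then show "j \<in> V'" using U C by (auto simp: closed_pair_def)
  qed
qed

text \<open>
  A component of the sum either meets the rows of the irreducible block and then contains that
  block, or it avoids the block and is a component of the remainder. Both have more than \<open>r\<close> rows.
\<close>

lemma direct_sum_large2:
  assumes A: "A \<in> irreducible2 U V" and B: "B \<in> large2 r (S - U) (T - V)"
    and sub: "U \<subseteq> S" "V \<subseteq> T" and fin: "finite S" "finite T" and r: "r < card U"
  shows "(\<lambda>i j. A i j + B i j) \<in> large2 r S T"
proof -
  have reg: "A \<in> regular 2 U V" "B \<in> regular 2 (S - U) (T - V)"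
    using A B by (auto simp: irreducible2_def large2_def)
  have "r < card U'" if C: "component S T (\<lambda>i j. A i j + B i j) U' V'" for U' V'
  proof (cases "U \<inter> U' = {}")
    case False
    then obtain i where i: "i \<in> U" "i \<in> U'" by blast
    have "closed_pair A U' V'" using C by (auto simp: component_def closed_pair_def)
    then have "U \<subseteq> U'" using component_irreducible_subset[OF A _ i] by blast
    moreover have "finite U'" using C fin by (auto simp: component_def intro: finite_subset)
    ultimately have "card U \<le> card U'" by (simp add: card_mono)
    with r show ?thesis by simp
  next
    case True
    have "V \<inter> V' = {}"
    proof (rule ccontr)
      assume "V \<inter> V' \<noteq> {}"
      then obtain j where j: "j \<in> V" "j \<in> V'" by blast
      then obtain i where i: "i \<in> U" "A i j \<noteq> 0"
        using reg(1) by (auto elim: regular_col_nonzero)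
      then have "i \<in> U'" using C j unfolding component_def closed_pair_def by auto
      with i True show False by blast
    qed
    then have "component (S - U) (T - V) B U' V'"
      using C True unfolding component_def closed_pair_def by auto
    then show ?thesis using B by (auto simp: large2_def)
  qed
  then show ?thesis
    using regular_direct_sum[OF reg sub fin] unfolding large2_def by blast
qed

text \<open>
  Among the components through \<open>s\<close> take one with the fewest rows. A proper
  subcomponent would either contain \<open>s\<close>, or its complement in the component would be a smaller
  component through \<open>s\<close>.
\<close>

lemma ex_irreducible_through:
  assumes A: "A \<in> regular 2 S T" and fin: "finite S" "finite T" and s: "s \<in> S"
  obtains U V where "component S T A U V" "s \<in> U" "restrict_mat A U V \<in> irreducible2 U V"
proof -
  define P where "P = (\<lambda>(U, V). component S T A U V \<and> s \<in> U)"
  have "P (S, T)" using A s by (auto simp: P_def component_def closed_pair_def dest: regular_pos)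
  from ex_has_least_nat[of P, OF this, of "\<lambda>(U, V). card U"]
  obtain U V where UV: "component S T A U V" "s \<in> U"
    and least: "\<And>U' V'. component S T A U' V' \<Longrightarrow> s \<in> U' \<Longrightarrow> card U \<le> card U'"
    by (auto simp: P_def)
  have sub: "U \<subseteq> S" "V \<subseteq> T" and cl: "closed_pair A U V"
    using UV by (auto simp: component_def)
  have finU: "finite U" using sub fin by (auto intro: finite_subset)
  have "U' = U" if C: "component U V (restrict_mat A U V) U' V'" for U' V'
  proof -
    note CS = component_restrict_mat[OF C cl sub]
    show ?thesis
    proof (cases "s \<in> U'")
      case True
      have "U' \<subseteq> U" using C by (simp add: component_def)
      then show ?thesis using card_seteq[OF finU] least[OF CS True] by blast
    next
      case False
      have "component S T A (U - U') (V - V')"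
        using component_Diff[OF UV(1) CS] False UV(2) by blast
      from least[OF this] False UV(2) have "card U \<le> card (U - U')" by simp
      moreover have "U' \<subseteq> U" "U' \<noteq> {}" using C by (auto simp: component_def)
      then have "card (U - U') < card U"
        using finU by (intro psubset_card_mono) auto
      ultimately show ?thesis by simp
    qed
  qed
  then have "restrict_mat A U V \<in> irreducible2 U V"
    using restrict_mat_regular[OF A cl sub fin] UV(2) by (auto simp: irreducible2_def)
  with UV that show ?thesis by blast
qed

text \<open>
  The decomposition behind the exponential formula: a matrix is determined by the
  irreducible block containing a fixed row \<open>s\<close> together with what remains after deleting the rows
  and columns of that block. Injectivity holds because two irreducible blocks that share
  the row \<open>s\<close> contain each other.
\<close>

lemma bij_betw_first_component:
  assumes fin: "finite S" "finite T" and s: "s \<in> S"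
  shows "bij_betw (\<lambda>((U, V), A, B). \<lambda>i j. A i j + B i j)
     (SIGMA (U, V):{(U, V). U \<subseteq> S \<and> V \<subseteq> T \<and> s \<in> U \<and> r < card U}.
        irreducible2 U V \<times> large2 r (S - U) (T - V))
     (large2 r S T)"
    (is "bij_betw ?f (Sigma ?X ?Y) _")
proof (rule bij_betw_imageI)
  show "inj_on ?f (Sigma ?X ?Y)"
  proof (rule inj_onI)
    fix p q assume p: "p \<in> Sigma ?X ?Y" and q: "q \<in> Sigma ?X ?Y" and eq: "?f p = ?f q"
    obtain U V A B where p_eq: "p = ((U, V), A, B)" by (metis prod.exhaust)
    obtain U' V' A' B' where q_eq: "q = ((U', V'), A', B')" by (metis prod.exhaust)
    have e: "A i j + B i j = A' i j + B' i j" for i j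
      using eq p_eq q_eq by (auto dest: fun_cong)
    have pp: "U \<subseteq> S" "V \<subseteq> T" "s \<in> U" "A \<in> irreducible2 U V" "A \<in> regular 2 U V"
        "B \<in> regular 2 (S - U) (T - V)"
      using p p_eq by (auto simp: irreducible2_def large2_def)
    have qq: "U' \<subseteq> S" "V' \<subseteq> T" "s \<in> U'" "A' \<in> irreducible2 U' V'" "A' \<in> regular 2 U' V'"
        "B' \<in> regular 2 (S - U') (T - V')"
      using q q_eq by (auto simp: irreducible2_def large2_def)
    have "closed_pair A U' V'"
      using closed_pair_direct_sum[OF qq(5,6)] by (auto simp: closed_pair_def e[symmetric])
    moreover have "closed_pair A' U V"
      using closed_pair_direct_sum[OF pp(5,6)] by (auto simp: closed_pair_def e)
    ultimately have UV: "U = U'" "V = V'"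
      using component_irreducible_subset[OF pp(4) _ pp(3) qq(3)]
        component_irreducible_subset[OF qq(4) _ qq(3) pp(3)] by blast+
    have "A i j = A' i j \<and> B i j = B' i j" for i j
      using e[of i j] UV pp(5,6) qq(5,6)
      by (cases "i \<in> U \<and> j \<in> V") (auto simp: regular_zero)
    then have "A = A'" "B = B'" by auto
    with UV p_eq q_eq show "p = q" by simp
  qed
  show "?f ` Sigma ?X ?Y = large2 r S T"
  proof (intro equalityI subsetI)
    fix M assume "M \<in> ?f ` Sigma ?X ?Y"
    then show "M \<in> large2 r S T"
      by (auto intro!: direct_sum_large2 fin)
  next
    fix M assume M: "M \<in> large2 r S T"
    then have reg: "M \<in> regular 2 S T" by (simp add: large2_def)
    obtain U V where UV: "component S T M U V" "s \<in> U" "restrict_mat M U V \<in> irreducible2 U V"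
      using ex_irreducible_through[OF reg fin s] .
    have sub: "U \<subseteq> S" "V \<subseteq> T" and cl: "closed_pair M U V"
      using UV by (auto simp: component_def)
    have "r < card U" using M UV by (auto simp: large2_def)
    moreover have "restrict_mat M (S - U) (T - V) \<in> large2 r (S - U) (T - V)"
    proof -
      note cl' = closed_pair_Diff[OF reg cl]
      have "component S T M U' V'"
        if "component (S - U) (T - V) (restrict_mat M (S - U) (T - V)) U' V'" for U' V'
        using component_restrict_mat[OF that cl'] by blast
      then show ?thesis
        using M restrict_mat_regular[OF reg cl' _ _ fin] by (auto simp: large2_def)
    qed
    ultimately have "((U, V), restrict_mat M U V, restrict_mat M (S - U) (T - V)) \<in> Sigma ?X ?Y"
      using UV sub by auto
    moreover have "?f ((U, V), restrict_mat M U V, restrict_mat M (S - U) (T - V)) = M"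
      using restrict_mat_split[OF reg cl sub] by simp
    ultimately show "M \<in> ?f ` Sigma ?X ?Y" by (metis (no_types, lifting) image_eqI)
  qed
qed

lemma large2_0: "finite S \<Longrightarrow> large2 0 S T = regular 2 S T"
  by (auto simp: large2_def component_def card_gt_0_iff dest: finite_subset)

text \<open>
  Summing the decomposition over all choices of \<open>s\<close> produces the factor \<open>n\<close> on the left, and counts
  every block \<open>(U, V)\<close> once for each of its rows on the right. There are \<open>(n choose k)\<^sup>2\<close> blocks
  with \<open>k\<close> rows and \<open>k\<close> columns. The weight \<open>f\<close> is arbitrary because the recurrence is used twice: with
  the number of factorisations into permutation matrices and with \<open>1\<close>.
\<close>

lemma sum_large2_recurrence:
  fixes f :: "nmat \<Rightarrow> 'a :: comm_semiring_1"
  assumes fin: "finite S" "finite T" and n: "card S = n" "card T = n"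
    and h: "\<And>U V. U \<subseteq> S \<Longrightarrow> V \<subseteq> T \<Longrightarrow> card U = card V \<Longrightarrow> r < card U \<Longrightarrow>
      (\<Sum>A\<in>irreducible2 U V. \<Sum>B\<in>large2 r (S - U) (T - V). f (\<lambda>i j. A i j + B i j)) = h (card U)"
  shows "of_nat n * (\<Sum>A\<in>large2 r S T. f A) = (\<Sum>k\<in>{r<..n}. of_nat (k * (n choose k)\<^sup>2) * h k)"
proof -
  define F where "F = (\<lambda>(U, V). \<Sum>A\<in>irreducible2 U V. \<Sum>B\<in>large2 r (S - U) (T - V). f (\<lambda>i j. A i j + B i j))"
  define X where "X = {(U, V). U \<subseteq> S \<and> V \<subseteq> T \<and> r < card U}"
  define X' where "X' = {(U, V). U \<subseteq> S \<and> V \<subseteq> T \<and> r < card U \<and> card U = card V}"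
  have "X \<subseteq> Pow S \<times> Pow T" by (auto simp: X_def)
  then have finX: "finite X" using fin by (auto intro: finite_subset)
  have X': "X' \<subseteq> X" by (auto simp: X_def X'_def)
  have finX': "finite X'" using finX X' by (rule finite_subset[rotated])
  have step: "(\<Sum>A\<in>large2 r S T. f A) = (\<Sum>p\<in>X. if s \<in> fst p then F p else 0)" if s: "s \<in> S" for s
  proof -
    let ?X = "{(U, V). U \<subseteq> S \<and> V \<subseteq> T \<and> s \<in> U \<and> r < card U}"
    let ?Y = "\<lambda>(U, V). irreducible2 U V \<times> large2 r (S - U) (T - V)"
    let ?f = "\<lambda>((U :: nat set, V :: nat set), A, B). \<lambda>i j. A i j + (B i j :: nat)"
    have sub: "?X \<subseteq> X" by (auto simp: X_def)
    then have finX2: "finite ?X" using finX by (rule finite_subset)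
    have finY: "finite (?Y p)" if "p \<in> ?X" for p
    proof -
      obtain U V where p: "p = (U, V)" by (cases p)
      then have "finite U" "finite V"
        using that fin by (auto intro: finite_subset)
      then show ?thesis using p fin by simp
    qed
    have "(\<Sum>A\<in>large2 r S T. f A) = (\<Sum>q\<in>Sigma ?X ?Y. f (?f q))"
      by (rule sum.reindex_bij_betw[OF bij_betw_first_component[OF fin s], symmetric])
    also have "\<dots> = (\<Sum>p\<in>?X. \<Sum>c\<in>?Y p. f (?f (p, c)))"
      using finX2 finY by (subst sum.Sigma) (auto simp del: split_paired_All simp: split_beta)
    also have "\<dots> = (\<Sum>p\<in>?X. F p)"
    proof (intro sum.cong refl)
      fix p assume "p \<in> ?X"
      obtain U V where p: "p = (U, V)" by (cases p)
      show "(\<Sum>c\<in>?Y p. f (?f (p, c))) = F p"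
        unfolding p F_def by (simp add: sum.cartesian_product split_beta)
    qed
    also have "\<dots> = (\<Sum>p\<in>X. if s \<in> fst p then F p else 0)"
      using finX by (intro sum.mono_neutral_cong_left) (auto simp: X_def)
    finally show ?thesis .
  qed
  have "of_nat n * (\<Sum>A\<in>large2 r S T. f A) = (\<Sum>s\<in>S. \<Sum>A\<in>large2 r S T. f A)"
    using n by simp
  also have "\<dots> = (\<Sum>s\<in>S. \<Sum>p\<in>X. if s \<in> fst p then F p else 0)"
    by (intro sum.cong step refl)
  also have "\<dots> = (\<Sum>p\<in>X. \<Sum>s\<in>S. if s \<in> fst p then F p else 0)"
    by (rule sum.swap)
  also have "\<dots> = (\<Sum>p\<in>X. of_nat (card (fst p)) * F p)"
  proof (intro sum.cong refl)
    fix p assume "p \<in> X"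
    then have sub: "fst p \<subseteq> S" by (auto simp: X_def)
    have "(\<Sum>s\<in>S. if s \<in> fst p then F p else 0) = (\<Sum>s\<in>S \<inter> fst p. F p)"
      by (rule sum.inter_restrict[OF fin(1), symmetric])
    also have "S \<inter> fst p = fst p" using sub by blast
    finally show "(\<Sum>s\<in>S. if s \<in> fst p then F p else 0) = of_nat (card (fst p)) * F p"
      by simp
  qed
  also have "\<dots> = (\<Sum>p\<in>X'. of_nat (card (fst p)) * h (card (fst p)))"
  proof (intro sum.mono_neutral_cong_right finX X' ballI)
    fix p assume "p \<in> X - X'"
    then have "card (fst p) \<noteq> card (snd p)" by (auto simp: X_def X'_def)
    then have "irreducible2 (fst p) (snd p) = {}"
      using regular_card_eq by (fastforce simp: irreducible2_def)
    then show "of_nat (card (fst p)) * F p = 0" by (simp add: F_def split_beta)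
  next
    fix p assume "p \<in> X'"
    then show "of_nat (card (fst p)) * F p = of_nat (card (fst p)) * h (card (fst p))"
      by (auto simp: X'_def F_def h)
  qed
  also have "\<dots> = (\<Sum>k\<in>{r<..n}. \<Sum>p\<in>{p\<in>X'. card (fst p) = k}. of_nat (card (fst p)) * h (card (fst p)))"
  proof (rule sum.group[symmetric, OF finX'])
    show "(\<lambda>p. card (fst p)) ` X' \<subseteq> {r<..n}"
      using fin(1) n(1) by (auto simp: X'_def dest!: card_mono[OF fin(1)])
  qed simp
  also have "\<dots> = (\<Sum>k\<in>{r<..n}. of_nat (k * (n choose k)\<^sup>2) * h k)"
  proof (intro sum.cong refl)
    fix k assume k: "k \<in> {r<..n}"
    have eq: "{p\<in>X'. card (fst p) = k} = {U. U \<subseteq> S \<and> card U = k} \<times> {V. V \<subseteq> T \<and> card V = k}"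
      using k by (auto simp: X'_def)
    have "card {p\<in>X'. card (fst p) = k} = (n choose k)\<^sup>2"
      unfolding eq card_cartesian_product using fin n by (simp add: n_subsets power2_eq_square)
    then show "(\<Sum>p\<in>{p\<in>X'. card (fst p) = k}. of_nat (card (fst p)) * h (card (fst p)))
        = of_nat (k * (n choose k)\<^sup>2) * h k"
      by (simp add: algebra_simps)
  qed
  finally show ?thesis .
qed

section \<open>Factorisations into permutation matrices\<close>

definition unit_mat :: "nat \<Rightarrow> nat \<Rightarrow> nat \<Rightarrow> nmat" where
  "unit_mat d s t = (\<lambda>i j. if i = s \<and> j = t then d else 0)"

lemma unit_mat_regular: "unit_mat d s t \<in> regular d {s} {t}"
  by (auto simp: regular_def unit_mat_def)

lemma regular_transpose: "A \<in> regular d S T \<Longrightarrow> (\<lambda>i j. A j i) \<in> regular d T S"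
  by (auto simp: regular_def)

lemma regular_row_two:
  assumes "A \<in> regular d S T" "finite T" "j \<noteq> j'"
  shows "A i j + A i j' \<le> d"
proof (cases "i \<in> S \<and> j \<in> T \<and> j' \<in> T")
  case True
  have "A i j + A i j' = (\<Sum>k\<in>{j, j'}. A i k)" using assms by simp
  also have "\<dots> \<le> (\<Sum>k\<in>T. A i k)" using assms True by (intro sum_mono2) auto
  finally show ?thesis using assms True by (simp add: regular_row)
next
  case False
  then show ?thesis
    using assms regular_entry_le[OF assms(1,2), of i] by (auto simp: regular_zero)
qed

lemma regular_col_two:
  assumes "A \<in> regular d S T" "finite S" "i \<noteq> i'"
  shows "A i j + A i' j \<le> d"
  using regular_row_two[OF regular_transpose[OF assms(1)] assms(2,3)] .

lemma closed_pair_full_entry: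
  assumes "A \<in> regular d S T" "finite S" "finite T" "A s t = d" "d > 0"
  shows "closed_pair A {s} {t}"
proof -
  have "j = t" if "A s j \<noteq> 0" for j
    using regular_row_two[OF assms(1,3), of j t s] that assms(4) by fastforce
  moreover have "i = s" if "A i t \<noteq> 0" for i
    using regular_col_two[OF assms(1,2), of i s t] that assms(4) by fastforce
  ultimately show ?thesis by (auto simp: closed_pair_def)
qed

lemma regular1_row_unique:
  assumes "B \<in> regular 1 S T" "finite T" "B i j \<noteq> 0" "B i j' \<noteq> 0"
  shows "j = j'"
  using regular_row_two[OF assms(1,2), of j j' i] assms(3,4) by fastforce

lemma regular1_row:
  assumes "B \<in> regular 1 S T" "finite T" "i \<in> S"
  obtains j where "j \<in> T" "B i j = 1"
  using regular_row_nonzero[OF assms(1) _ assms(3)] regular_entry_le[OF assms(1,2)]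
  by (metis le_antisym less_one linorder_not_less zero_less_one)

lemma regular1_col:
  assumes "B \<in> regular 1 S T" "finite S" "j \<in> T"
  obtains i where "i \<in> S" "B i j = 1"
  using regular1_row[OF regular_transpose[OF assms(1)] assms(2,3)] .

text \<open>
  Expansion along the row \<open>s\<close>: the column of its entry \<open>1\<close> is free, and the rest is a
  permutation matrix of smaller size.
\<close>

lemma card_regular1:
  assumes "finite S" "finite T" "card T = card S"
  shows "card (regular 1 S T) = fact (card S)"
  using assms
proof (induction S arbitrary: T rule: finite_induct)
  case empty
  then have "T = {}" by simp
  then have "regular 1 {} T = {\<lambda>_ _. 0}" by (auto simp: regular_def)
  then show ?case by simp
next
  case (insert s S)
  let ?f = "\<lambda>(t, B). \<lambda>i j. unit_mat 1 s t i j + B i j"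
  let ?D = "SIGMA t:T. regular 1 S (T - {t})"
  have S: "insert s S - {s} = S" using insert.hyps insert.prems by auto
  have fin: "finite (insert s S)" using insert.hyps insert.prems by simp
  have "bij_betw ?f ?D (regular 1 (insert s S) T)"
  proof (rule bij_betw_imageI)
    show "inj_on ?f ?D"
    proof (rule inj_onI)
      fix p q assume p: "p \<in> ?D" and q: "q \<in> ?D" and eq: "?f p = ?f q"
      obtain t B t' B' where pq: "p = (t, B)" "q = (t', B')" by (metis prod.exhaust)
      have e: "unit_mat 1 s t i j + B i j = unit_mat 1 s t' i j + B' i j" for i j
        using eq pq by (auto dest: fun_cong)
      have z: "B s j = 0" "B' s j = 0" for j
        using p q pq \<open>s \<notin> S\<close> by (auto simp: regular_zero)
      have "t = t'" using e[of s t] z by (auto simp: unit_mat_def split: if_splits)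
      moreover have "B i j = B' i j" for i j using e[of i j] \<open>t = t'\<close> by simp
      ultimately show "p = q" using pq by auto
    qed
    show "?f ` ?D = regular 1 (insert s S) T"
    proof (intro equalityI subsetI)
      fix M assume "M \<in> ?f ` ?D"
      then obtain t B where "t \<in> T" "B \<in> regular 1 S (T - {t})"
          "M = (\<lambda>i j. unit_mat 1 s t i j + B i j)" by auto
      then show "M \<in> regular 1 (insert s S) T"
        using regular_direct_sum[OF unit_mat_regular, of B 1 "insert s S" s T t] S fin insert.hyps insert.prems by auto
    next
      fix M assume M: "M \<in> regular 1 (insert s S) T"
      obtain t where t: "t \<in> T" "M s t = 1"
        using regular1_row[OF M] insert.hyps insert.prems by blast
      have cl: "closed_pair M {s} {t}"
        using closed_pair_full_entry[OF M] t insert.hyps insert.prems by simp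
      have "restrict_mat M S (T - {t}) \<in> regular 1 S (T - {t})"
        using restrict_mat_regular[OF M closed_pair_Diff[OF M cl] _ _ fin] S insert.hyps insert.prems
        by (simp add: subset_insertI)
      moreover have "restrict_mat M {s} {t} = unit_mat 1 s t"
        using t by (auto simp: restrict_mat_def unit_mat_def fun_eq_iff)
      ultimately show "M \<in> ?f ` ?D"
        using restrict_mat_split[OF M cl] t S by (intro image_eqI[of _ _ "(t, restrict_mat M S (T - {t}))"]) auto
    qed
  qed
  then have "card (regular 1 (insert s S) T) = card ?D"
    by (simp add: bij_betw_same_card)
  also have "\<dots> = (\<Sum>t\<in>T. card (regular 1 S (T - {t})))"
    using insert.hyps insert.prems by (intro card_SigmaI) auto
  also have "\<dots> = (\<Sum>t\<in>T. fact (card S))"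
    using insert.hyps insert.prems by (intro sum.cong insert.IH) auto
  finally show ?case using insert.hyps insert.prems by simp
qed

text \<open>
  The matrices \<open>B\<close> in a factorisation \<open>A = B + C\<close> into two permutation matrices; \<open>C\<close> is determined
  as \<open>A - B\<close>.
\<close>

definition factors :: "nat set \<Rightarrow> nat set \<Rightarrow> nmat \<Rightarrow> nmat set" where
  "factors S T A = {B \<in> regular 1 S T. \<forall>i j. B i j \<le> A i j}"

lemma finite_factors [simp]: "finite S \<Longrightarrow> finite T \<Longrightarrow> finite (factors S T A)"
  by (simp add: factors_def)

lemma regular_diff:
  assumes "A \<in> regular d S T" "B \<in> regular e S T" "\<And>i j. B i j \<le> A i j"
  shows "(\<lambda>i j. A i j - B i j) \<in> regular (d - e) S T"
  using assms by (auto simp: regular_def sum_subtractf_nat)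

text \<open>
  The left-hand side counts ordered pairs of permutation matrices, grouped by their sum.
\<close>

lemma sum_card_factors:
  assumes "finite S" "finite T" "card T = card S"
  shows "(\<Sum>A\<in>regular 2 S T. card (factors S T A)) = (fact (card S))\<^sup>2"
proof -
  let ?f = "\<lambda>(B, C). (\<lambda>i j. B i j + C i j :: nat, B)"
  have "bij_betw ?f (regular 1 S T \<times> regular 1 S T) (SIGMA A:regular 2 S T. factors S T A)"
  proof (rule bij_betwI[where g = "\<lambda>(A, B). (B, \<lambda>i j. A i j - B i j)"])
    show "?f \<in> regular 1 S T \<times> regular 1 S T \<rightarrow> (SIGMA A:regular 2 S T. factors S T A)"
      by (auto simp: regular_def factors_def sum.distrib)
    show "(\<lambda>(A, B). (B, \<lambda>i j. A i j - B i j)) \<in> (SIGMA A:regular 2 S T. factors S T A)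
        \<rightarrow> regular 1 S T \<times> regular 1 S T"
      using regular_diff[of _ 2 S T _ 1] by (auto simp: factors_def)
  qed (auto simp: factors_def)
  then have "card (regular 1 S T \<times> regular 1 S T) = card (SIGMA A:regular 2 S T. factors S T A)"
    by (rule bij_betw_same_card)
  also have "\<dots> = (\<Sum>A\<in>regular 2 S T. card (factors S T A))"
    using assms by (intro card_SigmaI) auto
  finally show ?thesis
    using card_regular1[OF assms] by (simp add: card_cartesian_product power2_eq_square)
qed

text \<open>
  The number of factorisations is multiplicative over blocks because a permutation matrix below
  a direct sum splits along the same blocks.
\<close>

lemma card_factors_direct_sum:
  assumes A: "A \<in> regular 2 U V" and B: "B \<in> regular 2 (S - U) (T - V)"
    and sub: "U \<subseteq> S" "V \<subseteq> T" and fin: "finite S" "finite T"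
  shows "card (factors S T (\<lambda>i j. A i j + B i j)) = card (factors U V A) * card (factors (S - U) (T - V) B)"
proof -
  let ?f = "\<lambda>(P, Q). \<lambda>i j. P i j + Q i j :: nat"
  let ?M = "\<lambda>i j. A i j + B i j"
  have "bij_betw ?f (factors U V A \<times> factors (S - U) (T - V) B) (factors S T ?M)"
  proof (rule bij_betwI[where g = "\<lambda>R. (restrict_mat R U V, restrict_mat R (S - U) (T - V))"])
    show "?f \<in> factors U V A \<times> factors (S - U) (T - V) B \<rightarrow> factors S T ?M"
      using sub fin by (auto simp: factors_def intro!: regular_direct_sum add_mono)
    show "(\<lambda>R. (restrict_mat R U V, restrict_mat R (S - U) (T - V)))
        \<in> factors S T ?M \<rightarrow> factors U V A \<times> factors (S - U) (T - V) B"
    proof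
      fix R assume "R \<in> factors S T ?M"
      then have R: "R \<in> regular 1 S T" "R i j \<le> ?M i j" for i j
        by (auto simp: factors_def)
      have cl: "closed_pair R U V"
        using closed_pair_direct_sum[OF A B] R(2) unfolding closed_pair_def
        by (metis le_zero_eq)
      have "restrict_mat R U V i j \<le> A i j" for i j
        using R(2)[of i j] B by (auto simp: restrict_mat_def regular_zero)
      moreover have "restrict_mat R (S - U) (T - V) i j \<le> B i j" for i j
        using R(2)[of i j] A by (auto simp: restrict_mat_def regular_zero)
      ultimately show "(restrict_mat R U V, restrict_mat R (S - U) (T - V))
          \<in> factors U V A \<times> factors (S - U) (T - V) B"
        using restrict_mat_regular[OF R(1) cl sub fin]
          restrict_mat_regular[OF R(1) closed_pair_Diff[OF R(1) cl] _ _ fin]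
        by (auto simp: factors_def)
    qed
    show "(restrict_mat (?f p) U V, restrict_mat (?f p) (S - U) (T - V)) = p"
      if "p \<in> factors U V A \<times> factors (S - U) (T - V) B" for p
    proof -
      obtain P Q where p: "p = (P, Q)" by (cases p)
      have PQ: "P \<in> regular 1 U V" "Q \<in> regular 1 (S - U) (T - V)"
        using that p by (auto simp: factors_def)
      have "restrict_mat (?f p) U V i j = P i j" for i j
        using PQ p by (auto simp: restrict_mat_def regular_zero)
      moreover have "restrict_mat (?f p) (S - U) (T - V) i j = Q i j" for i j
        using PQ p by (auto simp: restrict_mat_def regular_zero)
      ultimately show ?thesis unfolding p by (simp add: fun_eq_iff)
    qed
    show "?f (restrict_mat R U V, restrict_mat R (S - U) (T - V)) = R" if "R \<in> factors S T ?M" for R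
    proof -
      have R: "R \<in> regular 1 S T" "R i j \<le> ?M i j" for i j
        using that by (auto simp: factors_def)
      have cl: "closed_pair R U V"
        using closed_pair_direct_sum[OF A B] R(2) unfolding closed_pair_def
        by (metis le_zero_eq)
      show ?thesis using restrict_mat_split[OF R(1) cl sub] by simp
    qed
  qed
  then show ?thesis by (simp add: bij_betw_same_card[symmetric] card_cartesian_product)
qed

lemma regular_le_imp_eq:
  assumes B: "B \<in> regular d S T" and C: "C \<in> regular d S T" and le: "\<And>i j. B i j \<le> C i j"
    and fin: "finite T"
  shows "B = C"
proof (intro ext)
  fix i j
  show "B i j = C i j"
  proof (cases "i \<in> S \<and> j \<in> T")
    case True
    have "C i j - B i j \<le> (\<Sum>j\<in>T. C i j - B i j)"
      using True fin by (intro member_le_sum) auto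
    also have "\<dots> = 0"
      using B C True le by (simp add: sum_subtractf_nat regular_row)
    finally show ?thesis using le[of i j] by simp
  next
    case False
    then show ?thesis using B C by (auto simp: regular_zero)
  qed
qed

text \<open>
  A regular bipartite multigraph has a perfect matching. For degree two this needs no matching
  theory: if the row \<open>s\<close> has entries \<open>1\<close> in the columns \<open>a\<close> and \<open>b\<close>, delete the row and add column
  \<open>b\<close> to column \<open>a\<close>. The smaller matrix dominates a permutation matrix by induction, whose entry in
  the merged column lies in some row \<open>p\<close>. That entry is returned to whichever of the two columns is nonzero
  in row \<open>p\<close>, and the row \<open>s\<close> is matched with the other one.
\<close>

lemma ex_factor:
  assumes "finite S" "finite T" "A \<in> regular 2 S T"
  shows "factors S T A \<noteq> {}"
  using assms
proof (induction "card S" arbitrary: S T A)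
  case 0
  then have "S = {}" "T = {}" using regular_card_eq[OF 0(4)] by auto
  then have "(\<lambda>_ _. 0) \<in> factors S T A" by (auto simp: factors_def regular_def)
  then show ?case by blast
next
  case (Suc n)
  note fin = \<open>finite S\<close> \<open>finite T\<close> and A = \<open>A \<in> regular 2 S T\<close>
  obtain s where s: "s \<in> S" using \<open>Suc n = card S\<close> by fastforce
  have n: "n = card (S - {s})" using \<open>Suc n = card S\<close> s fin by simp
  obtain a where a: "a \<in> T" "A s a \<noteq> 0" using regular_row_nonzero[OF A _ s] by auto
  show ?case
  proof (cases "A s a = 2")
    case True
    have cl: "closed_pair A {s} {a}" using closed_pair_full_entry[OF A fin True] by simp
    have R: "restrict_mat A (S - {s}) (T - {a}) \<in> regular 2 (S - {s}) (T - {a})"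
      using restrict_mat_regular[OF A closed_pair_Diff[OF A cl] _ _ fin] by blast
    obtain B where "B \<in> factors (S - {s}) (T - {a}) (restrict_mat A (S - {s}) (T - {a}))"
      using Suc.hyps(1)[OF n _ _ R] fin by auto
    then have B: "B \<in> regular 1 (S - {s}) (T - {a})" "B i j \<le> restrict_mat A (S - {s}) (T - {a}) i j" for i j
      by (auto simp: factors_def)
    have "(\<lambda>i j. unit_mat 1 s a i j + B i j) \<in> regular 1 S T"
      using regular_direct_sum[OF unit_mat_regular B(1)] s a fin by simp
    moreover have "unit_mat 1 s a i j + B i j \<le> A i j" for i j
      using B(2)[of i j] True by (auto simp: unit_mat_def restrict_mat_def split: if_splits)
    ultimately show ?thesis by (auto simp: factors_def)
  next
    case False
    have sa: "A s a = 1" using False a regular_entry_le[OF A fin(2), of s a] by linarith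
    have row: "(\<Sum>j\<in>T - {a}. A s j) = 1"
      using regular_row[OF A s] a fin sa by (simp add: sum_diff1_nat)
    then obtain b where b: "b \<in> T" "b \<noteq> a" "A s b \<noteq> 0"
      by (metis DiffE insertI1 one_neq_zero sum.neutral)
    have "A s b \<le> (\<Sum>j\<in>T - {a}. A s j)" using b fin by (intro member_le_sum) auto
    then have sb: "A s b = 1" using b row by simp
    have "(\<Sum>j\<in>T - {a} - {b}. A s j) = 0"
      using row sb b fin by (simp add: sum_diff1_nat)
    then have srest: "A s j = 0" if "j \<noteq> a" "j \<noteq> b" for j
      using that fin regular_zero[OF A, of s j] by (cases "j \<in> T") auto
    \<comment> \<open>the merged matrix: row \<open>s\<close> deleted, column \<open>b\<close> added to column \<open>a\<close>\<close>
    define A' where "A' = (\<lambda>i j. if i = s \<or> j = b then 0 else if j = a then A i a + A i b else A i j)"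
    have "A' \<in> regular 2 (S - {s}) (T - {b})"
    proof -
      have "(\<Sum>j\<in>T - {b}. A' i j) = 2" if i: "i \<in> S - {s}" for i
      proof -
        have "(\<Sum>j\<in>T - {b}. A' i j) = A' i a + (\<Sum>j\<in>T - {b} - {a}. A' i j)"
          using a b fin by (subst sum.remove[of _ a]) auto
        also have "(\<Sum>j\<in>T - {b} - {a}. A' i j) = (\<Sum>j\<in>T - {b} - {a}. A i j)"
          using i by (intro sum.cong) (auto simp: A'_def)
        also have "A' i a = A i b + A i a" using i b by (auto simp: A'_def)
        also have "A i b + A i a + (\<Sum>j\<in>T - {b} - {a}. A i j) = A i b + (\<Sum>j\<in>T - {b}. A i j)"
          using a b fin by (subst sum.remove[of "T - {b}" a]) auto
        also have "\<dots> = (\<Sum>j\<in>T. A i j)"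
          using b fin by (subst sum.remove[of T b]) auto
        also have "\<dots> = 2" using regular_row[OF A] i by simp
        finally show ?thesis .
      qed
      moreover have "(\<Sum>i\<in>S - {s}. A' i j) = 2" if j: "j \<in> T - {b}" for j
      proof -
        have rest: "(\<Sum>i\<in>S - {s}. A i k) = 2 - A s k" if "k \<in> T" for k
          using regular_col[OF A that] s fin by (simp add: sum_diff1_nat)
        have "(\<Sum>i\<in>S - {s}. A' i j) = (\<Sum>i\<in>S - {s}. if j = a then A i a + A i b else A i j)"
          using j by (intro sum.cong) (auto simp: A'_def)
        also have "\<dots> = 2"
          using rest[OF a(1)] rest[OF b(1)] rest[of j] sa sb srest[of j] j
          by (cases "j = a") (auto simp: sum.distrib)
        finally show ?thesis .
      qed
      moreover have "A' i j = 0" if "i \<notin> S - {s} \<or> j \<notin> T - {b}" for i j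
        using that regular_zero[OF A] a(1) by (auto simp: A'_def)
      ultimately show ?thesis by (auto simp: regular_def)
    qed
    then obtain B' where "B' \<in> factors (S - {s}) (T - {b}) A'"
      using Suc.hyps(1)[OF n] fin by blast
    then have B': "B' \<in> regular 1 (S - {s}) (T - {b})" and le: "\<And>i j. B' i j \<le> A' i j"
      by (auto simp: factors_def)
    obtain p where p: "p \<in> S - {s}" "B' p a = 1"
      using regular1_col[OF B', of a] fin a b by blast
    have other: "B' i a = 0" if "i \<noteq> p" for i
      using regular_col_two[OF B' _ that, of a] p fin by simp
    have B's: "B' s j = 0" "B' i b = 0" for i j using B' by (auto simp: regular_zero)
    have "1 \<le> A p a + A p b" using le[of p a] p b by (auto simp: A'_def)
    then consider "A p a \<ge> 1" | "A p b \<ge> 1" by linarith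
    then show ?thesis
    proof cases
      case 1
      have "(\<lambda>i j. unit_mat 1 s b i j + B' i j) \<in> regular 1 S T"
        using regular_direct_sum[OF unit_mat_regular B'] s b fin by simp
      moreover have "unit_mat 1 s b i j + B' i j \<le> A i j" for i j
      proof -
        have "B' i j \<le> A i j"
          using le[of i j] B's other[of i] p(2) 1 by (cases "j = a"; cases "i = p") (auto simp: A'_def split: if_splits)
        then show ?thesis using B's sb by (auto simp: unit_mat_def)
      qed
      ultimately show ?thesis by (auto simp: factors_def)
    next
      case 2
      \<comment> \<open>here row \<open>p\<close> keeps column \<open>b\<close>, so the merged column is renamed to \<open>b\<close> and \<open>a\<close> goes to \<open>s\<close>\<close>
      define B where "B = (\<lambda>i j. if j = b then B' i a else if j = a then 0 else B' i j)"
      have "B \<in> regular 1 (S - {s}) (T - {a})"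
      proof -
        have "(\<Sum>j\<in>T - {a}. B i j) = 1" if i: "i \<in> S - {s}" for i
        proof -
          have "(\<Sum>j\<in>T - {a}. B i j) = B i b + (\<Sum>j\<in>T - {a} - {b}. B i j)"
            using a b fin by (subst sum.remove[of _ b]) auto
          also have "(\<Sum>j\<in>T - {a} - {b}. B i j) = (\<Sum>j\<in>T - {b} - {a}. B' i j)"
            by (intro sum.cong) (auto simp: B_def)
          also have "B i b = B' i a" by (simp add: B_def)
          also have "B' i a + (\<Sum>j\<in>T - {b} - {a}. B' i j) = (\<Sum>j\<in>T - {b}. B' i j)"
            using a b fin by (subst sum.remove[of "T - {b}" a]) auto
          also have "\<dots> = 1" using regular_row[OF B'] i by simp
          finally show ?thesis .
        qed
        moreover have "(\<Sum>i\<in>S - {s}. B i j) = 1" if j: "j \<in> T - {a}" for j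
          using regular_col[OF B', of a] regular_col[OF B', of j] j a b
          by (cases "j = b") (auto simp: B_def)
        moreover have "B i j = 0" if "i \<notin> S - {s} \<or> j \<notin> T - {a}" for i j
          using that regular_zero[OF B'] b(1) by (auto simp: B_def)
        ultimately show ?thesis by (auto simp: regular_def)
      qed
      from regular_direct_sum[OF unit_mat_regular this]
      have "(\<lambda>i j. unit_mat 1 s a i j + B i j) \<in> regular 1 S T"
        using s a fin by simp
      moreover have "unit_mat 1 s a i j + B i j \<le> A i j" for i j
      proof -
        have "B i j \<le> A i j"
          using le[of i j] B's other[of i] p(2) 2 by (cases "j = b"; cases "i = p") (auto simp: A'_def B_def split: if_splits)
        moreover have "B s j = 0" using B's by (simp add: B_def)
        ultimately show ?thesis using sa by (auto simp: unit_mat_def)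
      qed
      ultimately show ?thesis by (auto simp: factors_def)
    qed
  qed
qed

text \<open>
  Suppose \<open>B\<close> and \<open>C\<close> agree in row \<open>i\<close>, and let \<open>j\<close> be the other neighbour of \<open>i\<close>. Neither matches \<open>i\<close> with \<open>j\<close>,
  and since column \<open>j\<close> has sum two, only one further entry is left for both of them to use: they agree in column \<open>j\<close> as well.
\<close>

lemma factors_agree_step:
  assumes fin: "finite S" "finite T" and A: "A \<in> regular 2 S T"
    and B: "B \<in> factors S T A" and C: "C \<in> factors S T A"
    and agree: "B i k = 1" "C i k = 1" and j: "A i j \<noteq> 0"
  shows "\<exists>i'. B i' j = 1 \<and> C i' j = 1"
proof (cases "j = k")
  case False
  have B: "B \<in> regular 1 S T" "\<And>i j. B i j \<le> A i j" and C: "C \<in> regular 1 S T" "\<And>i j. C i j \<le> A i j"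
    using B C by (auto simp: factors_def)
  have T: "j \<in> T" using regular_pos[OF A, of i j] j by simp
  obtain b where b: "b \<in> S" "B b j = 1" using regular1_col[OF B(1) fin(1) T] .
  obtain c where c: "c \<in> S" "C c j = 1" using regular1_col[OF C(1) fin(1) T] .
  have bi: "b \<noteq> i" using regular1_row_unique[OF B(1) fin(2), of i j k] False agree b by auto
  have ci: "c \<noteq> i" using regular1_row_unique[OF C(1) fin(2), of i j k] False agree c by auto
  have i: "i \<in> S" using regular_pos[OF A, of i j] j by simp
  have "b = c"
  proof (rule ccontr)
    assume "b \<noteq> c"
    \<comment> \<open>three nonzero entries would exceed the column sum\<close>
    have "A i j + A b j + A c j = (\<Sum>i\<in>{i, b, c}. A i j)"
      using \<open>b \<noteq> c\<close> bi ci by auto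
    also have "\<dots> \<le> (\<Sum>i\<in>S. A i j)"
      using i b c fin by (intro sum_mono2) auto
    also have "\<dots> = 2" using regular_col[OF A T] .
    finally show False using B(2)[of b j] C(2)[of c j] b c j by linarith
  qed
  then show ?thesis using b c by blast
qed (use agree in blast)

lemma factors_transpose:
  "B \<in> factors S T A \<Longrightarrow> (\<lambda>i j. B j i) \<in> factors T S (\<lambda>i j. A j i)"
  by (auto simp: factors_def regular_transpose)

lemma closed_pair_factors_agree:
  assumes fin: "finite S" "finite T" and A: "A \<in> regular 2 S T"
    and B: "B \<in> factors S T A" and C: "C \<in> factors S T A"
  shows "closed_pair A {i. \<exists>j. B i j = 1 \<and> C i j = 1} {j. \<exists>i. B i j = 1 \<and> C i j = 1}"
proof -
  have "\<exists>i'. B i' j = 1 \<and> C i' j = 1" if "A i j \<noteq> 0" "B i k = 1 \<and> C i k = 1" for i j k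
    using factors_agree_step[OF fin A B C] that by blast
  moreover have "\<exists>j'. B i j' = 1 \<and> C i j' = 1" if "A i j \<noteq> 0" "B k j = 1 \<and> C k j = 1" for i j k
    using factors_agree_step[OF fin(2,1) regular_transpose[OF A] factors_transpose[OF B] factors_transpose[OF C],
        of k j i] that by blast
  ultimately show ?thesis unfolding closed_pair_def by blast
qed

text \<open>
  The rows where two factors \<open>B\<close> and \<open>C\<close> agree form a component or the empty set
  (\<open>closed_pair_factors_agree\<close>). For irreducible \<open>A\<close> this leaves \<open>C = B\<close> and \<open>C = A - B\<close>, which differ unless \<open>A\<close> is the \<open>1 \<times> 1\<close> matrix
  with entry \<open>2\<close>. In graph terms, an even cycle of length at least four has two perfect matchings.
\<close>

lemma card_factors_irreducible:
  assumes fin: "finite S" "finite T" and irr: "A \<in> irreducible2 S T"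
  shows "card (factors S T A) = (if card S = 1 then 1 else 2)"
proof -
  have A: "A \<in> regular 2 S T" and ne: "S \<noteq> {}" and min: "\<And>U V. component S T A U V \<Longrightarrow> U = S"
    using irr by (auto simp: irreducible2_def)
  have ST: "card T = card S" using regular_card_eq[OF A] by simp
  obtain B where B: "B \<in> factors S T A" using ex_factor[OF fin A] by blast
  show ?thesis
  proof (cases "card S = 1")
    case True
    have "card (regular 1 S T) = 1" using card_regular1[OF fin ST] True by simp
    moreover have "factors S T A \<subseteq> regular 1 S T" by (auto simp: factors_def)
    ultimately have "factors S T A = {B}" using B by (fastforce simp: card_1_singleton_iff)
    then show ?thesis using True by simp
  next
    case False
    \<comment> \<open>an entry \<open>2\<close> is a component of size one\<close>
    have le1: "A i j \<le> 1" for i j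
    proof (rule ccontr)
      assume "\<not> A i j \<le> 1"
      then have ij: "A i j = 2" using regular_entry_le[OF A fin(2), of i j] by linarith
      then have "i \<in> S" "j \<in> T" using regular_pos[OF A, of i j] by auto
      then have "component S T A {i} {j}"
        using closed_pair_full_entry[OF A fin ij] by (simp add: component_def)
      from min[OF this] False show False by auto
    qed
    define B' where "B' = (\<lambda>i j. A i j - B i j)"
    have regB: "B \<in> regular 1 S T" and leB: "\<And>i j. B i j \<le> A i j" using B by (auto simp: factors_def)
    have regB': "B' \<in> regular 1 S T"
      using regular_diff[OF A regB leB] by (simp add: B'_def)
    then have B': "B' \<in> factors S T A" by (simp add: factors_def B'_def)
    have "C = B \<or> C = B'" if C: "C \<in> factors S T A" for C
    proof -
      have regC: "C \<in> regular 1 S T" and leC: "\<And>i j. C i j \<le> A i j" using C by (auto simp: factors_def)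
      define D where "D = {i. \<exists>j. B i j = 1 \<and> C i j = 1}"
      define E where "E = {j. \<exists>i. B i j = 1 \<and> C i j = 1}"
      have "closed_pair A D E"
        unfolding D_def E_def by (rule closed_pair_factors_agree[OF fin A B C])
      moreover have "i \<in> S" "j \<in> T" if "B i j = 1" for i j
        using regular_pos[OF regB, of i j] that by simp_all
      then have "D \<subseteq> S" "E \<subseteq> T" unfolding D_def E_def by blast+
      ultimately have "D = {} \<or> D = S"
        using min[of D E] by (auto simp: component_def)
      then show ?thesis
      proof
        assume D: "D = {}"
        have "C i j \<le> B' i j" for i j
        proof (cases "B i j = 0")
          case True
          then show ?thesis using leC by (simp add: B'_def)
        next
          case False
          then have "B i j = 1" using regular_entry_le[OF regB fin(2), of i j] by linarith
          then have "C i j \<noteq> 1" using D by (auto simp: D_def)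
          then have "C i j = 0" using regular_entry_le[OF regC fin(2), of i j] by linarith
          then show ?thesis by simp
        qed
        then show ?thesis using regular_le_imp_eq[OF regC regB' _ fin(2)] by blast
      next
        assume D: "D = S"
        have "B i j \<le> C i j" for i j
        proof (cases "B i j = 0")
          case False
          then have "i \<in> D" using D regular_pos[OF regB, of i j] by simp
          then obtain k where k: "B i k = 1" "C i k = 1" by (auto simp: D_def)
          then have "j = k" using regular1_row_unique[OF regB fin(2), of i j k] False by simp
          then show ?thesis using k by simp
        qed simp
        then show ?thesis using regular_le_imp_eq[OF regB regC _ fin(2)] by blast
      qed
    qed
    then have "factors S T A = {B, B'}" using B B' by blast
    moreover have "B \<noteq> B'"
    proof
      assume eq: "B = B'"
      obtain i where "i \<in> S" using ne by blast
      then obtain j where j: "B i j = 1" using regular1_row[OF regB fin(2)] by blast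
      have "B' i j = 0" using j le1[of i j] by (simp add: B'_def)
      with j eq show False by simp
    qed
    ultimately show ?thesis using False by simp
  qed
qed

section \<open>Counting irreducible matrices and matrices without small components\<close>

lemma choose_fact_squares:
  assumes "k \<le> n"
  shows "(of_nat (n choose k))\<^sup>2 * ((fact k)\<^sup>2 * (fact (n - k))\<^sup>2) = ((fact n)\<^sup>2 :: 'a :: field_char_0)"
  using assms by (simp add: binomial_fact power_divide power_mult_distrib)

text \<open>
  Let \<open>J\<^sub>k\<close> be the total number of factorisations of irreducible matrices of size \<open>k\<close>. Every matrix
  weighted by its factorisations gives the total \<open>(n!)\<^sup>2\<close>, so the recurrence divided by \<open>(n!)\<^sup>2\<close> becomes
  \<open>n = (\<Sum>k=1..n. k * J\<^sub>k / (k!)\<^sup>2)\<close>. By induction all summands but the last equal \<open>1\<close>, hence so does the last.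
  This counts the cycles of length \<open>2 k\<close> without parametrising them.
\<close>

lemma sum_card_factors_irreducible:
  assumes "finite S" "finite T" "card S = n" "card T = n" "n \<ge> 1"
  shows "real n * (\<Sum>A\<in>irreducible2 S T. real (card (factors S T A))) = (fact n)\<^sup>2"
  using assms
proof (induction n arbitrary: S T rule: less_induct)
  case (less n)
  note fin = less.prems(1,2) and n = less.prems(3,4)
  define w where "w = (\<lambda>S T A. real (card (factors S T A)))"
  have total: "(\<Sum>A\<in>large2 0 S T. w S T A) = (fact (card S))\<^sup>2"
    if "finite S" "finite T" "card T = card S" for S T
    using sum_card_factors[OF that] that
    by (simp add: w_def large2_0 flip: of_nat_sum)
  define J where "J = (\<Sum>A\<in>irreducible2 S T. w S T A)"
  \<comment> \<open>The value for \<open>k < n\<close> is supplied by the induction hypothesis; \<open>J\<close> is the unknown.\<close>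
  define h where "h = (\<lambda>k. if k = n then J else (fact k)\<^sup>2 / real k * (fact (n - k))\<^sup>2)"
  have "real n * (\<Sum>A\<in>large2 0 S T. w S T A) = (\<Sum>k\<in>{0<..n}. real (k * (n choose k)\<^sup>2) * h k)"
  proof (rule sum_large2_recurrence[OF fin n])
    fix U V assume U: "U \<subseteq> S" and V: "V \<subseteq> T" and eq: "card U = card V" and pos: "0 < card U"
    have finUV: "finite U" "finite V" using U V fin by (auto intro: finite_subset)
    have diff: "card (S - U) = n - card U" "card (T - V) = n - card U"
      using U V finUV n eq by (auto simp: card_Diff_subset)
    have le: "card U \<le> n" using card_mono[OF fin(1) U] n by simp
    have "(\<Sum>A\<in>irreducible2 U V. \<Sum>B\<in>large2 0 (S - U) (T - V). w S T (\<lambda>i j. A i j + B i j))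
        = (\<Sum>A\<in>irreducible2 U V. \<Sum>B\<in>large2 0 (S - U) (T - V). w U V A * w (S - U) (T - V) B)"
      by (intro sum.cong refl)
        (auto simp: w_def irreducible2_def large2_def card_factors_direct_sum[OF _ _ U V fin])
    also have "\<dots> = (\<Sum>A\<in>irreducible2 U V. w U V A) * (\<Sum>B\<in>large2 0 (S - U) (T - V). w (S - U) (T - V) B)"
      by (simp add: sum_product)
    also have "(\<Sum>B\<in>large2 0 (S - U) (T - V). w (S - U) (T - V) B) = (fact (n - card U))\<^sup>2"
      using total[of "S - U" "T - V"] fin diff by simp
    also have "(\<Sum>A\<in>irreducible2 U V. w U V A) * (fact (n - card U))\<^sup>2 = h (card U)"
    proof (cases "card U = n")
      case True
      then have "U = S" "V = T" using U V fin n eq by (auto simp: card_subset_eq)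
      then show ?thesis using True by (simp add: h_def J_def)
    next
      case False
      then have "real (card U) * (\<Sum>A\<in>irreducible2 U V. w U V A) = (fact (card U))\<^sup>2"
        using less.IH[OF _ finUV refl eq[symmetric]] le pos by (simp add: w_def)
      then have "(\<Sum>A\<in>irreducible2 U V. w U V A) = (fact (card U))\<^sup>2 / real (card U)"
        using pos by (simp add: eq_divide_eq mult.commute)
      then show ?thesis using False by (simp only: h_def if_False)
    qed
    finally show "(\<Sum>A\<in>irreducible2 U V. \<Sum>B\<in>large2 0 (S - U) (T - V). w S T (\<lambda>i j. A i j + B i j)) = h (card U)" .
  qed
  then have "real n * (fact n)\<^sup>2 = (\<Sum>k\<in>{0<..n}. real (k * (n choose k)\<^sup>2) * h k)"
    using total fin n by simp
  also have "{0<..n} = insert n {0<..<n}" using less.prems(5) by auto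
  also have "(\<Sum>k\<in>insert n {0<..<n}. real (k * (n choose k)\<^sup>2) * h k)
      = real n * J + (\<Sum>k\<in>{0<..<n}. real (k * (n choose k)\<^sup>2) * h k)"
    by (simp add: h_def)
  also have "(\<Sum>k\<in>{0<..<n}. real (k * (n choose k)\<^sup>2) * h k) = (\<Sum>k\<in>{0<..<n}. (fact n)\<^sup>2)"
  proof (intro sum.cong refl)
    fix k assume k: "k \<in> {0<..<n}"
    have "real (k * (n choose k)\<^sup>2) * h k = (real (n choose k))\<^sup>2 * ((fact k)\<^sup>2 * (fact (n - k))\<^sup>2)"
      using k by (simp add: h_def)
    also have "\<dots> = (fact n)\<^sup>2" using k by (intro choose_fact_squares) simp
    finally show "real (k * (n choose k)\<^sup>2) * h k = (fact n)\<^sup>2" .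
  qed
  also have "\<dots> = (real n - 1) * (fact n)\<^sup>2"
    using less.prems(5) by (simp add: of_nat_diff)
  finally have "real n * J = (fact n)\<^sup>2" by (simp add: algebra_simps)
  then show ?case by (simp add: J_def w_def)
qed

text \<open>
  The number of irreducible matrices of size \<open>k\<close> divided by \<open>(k!)\<^sup>2\<close>, which is also the limiting mean of
  the number of irreducible \<open>k\<close>-components. The size \<open>k = 1\<close> is exceptional because a double edge has one
  perfect matching only.
\<close>

definition component_rate :: "nat \<Rightarrow> real" where
  "component_rate k = (if k = 1 then 1 else 1 / (2 * real k))"

lemma card_irreducible2:
  assumes "finite S" "finite T" "card S = n" "card T = n" "n \<ge> 1"
  shows "real (card (irreducible2 S T)) = (fact n)\<^sup>2 * component_rate n"
proof -
  have "(\<Sum>A\<in>irreducible2 S T. real (card (factors S T A))) = (\<Sum>A\<in>irreducible2 S T. if n = 1 then 1 else 2)"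
    using assms by (intro sum.cong) (auto simp: card_factors_irreducible)
  then have "(fact n)\<^sup>2 = real n * (real (card (irreducible2 S T)) * (if n = 1 then 1 else 2))"
    using sum_card_factors_irreducible[OF assms] by simp
  then show ?thesis using assms(5) by (auto simp: component_rate_def field_simps)
qed

text \<open>
  The exponential formula \<open>(\<Sum>n. u n * x ^ n) = exp (\<Sum>k>r. component_rate k * x ^ k)\<close> in the form of
  the recurrence that results from differentiating it. The values of \<open>u\<close> are allowed in any field
  extending the reals, since the generating function is analysed over the complex numbers.
\<close>

lemma card_large2:
  fixes u :: "nat \<Rightarrow> 'a :: {real_algebra_1, field_char_0}"
  assumes u0: "u 0 = 1"
    and rec: "\<And>n. n \<ge> 1 \<Longrightarrow> of_nat n * u n = (\<Sum>k\<in>{r<..n}. of_nat k * of_real (component_rate k) * u (n - k))"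
    and "finite S" "finite T" "card S = n" "card T = n"
  shows "of_nat (card (large2 r S T)) = (fact n)\<^sup>2 * u n"
  using assms(3-)
proof (induction n arbitrary: S T rule: less_induct)
  case (less n)
  note fin = less.prems(1,2) and n = less.prems(3,4)
  show ?case
  proof (cases "n = 0")
    case True
    then have "S = {}" "T = {}" using fin n by auto
    then have "large2 r S T = {\<lambda>_ _. 0}" by (auto simp: large2_def regular_def component_def)
    then show ?thesis using True u0 by simp
  next
    case False
    define h where "h = (\<lambda>k. (fact k)\<^sup>2 * of_real (component_rate k) * ((fact (n - k))\<^sup>2 * u (n - k)))"
    have "of_nat n * (\<Sum>A\<in>large2 r S T. 1 :: 'a) = (\<Sum>k\<in>{r<..n}. of_nat (k * (n choose k)\<^sup>2) * h k)"
    proof (rule sum_large2_recurrence[OF fin n])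
      fix U V assume U: "U \<subseteq> S" and V: "V \<subseteq> T" and eq: "card U = card V" and r: "r < card U"
      have finUV: "finite U" "finite V" using U V fin by (auto intro: finite_subset)
      have diff: "card (S - U) = n - card U" "card (T - V) = n - card U"
        using U V finUV n eq by (auto simp: card_Diff_subset)
      have "real (card (irreducible2 U V)) = (fact (card U))\<^sup>2 * component_rate (card U)"
        using card_irreducible2[OF finUV] eq r by simp
      then have "of_real (real (card (irreducible2 U V))) = (of_real ((fact (card U))\<^sup>2 * component_rate (card U)) :: 'a)"
        by simp
      then have 1: "of_nat (card (irreducible2 U V)) = (fact (card U))\<^sup>2 * (of_real (component_rate (card U)) :: 'a)"
        by simp
      have 2: "of_nat (card (large2 r (S - U) (T - V))) = (fact (n - card U))\<^sup>2 * u (n - card U)"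
        by (rule less.IH) (use fin diff False r in auto)
      show "(\<Sum>A\<in>irreducible2 U V. \<Sum>B\<in>large2 r (S - U) (T - V). 1) = h (card U)"
        by (simp add: h_def 1 2)
    qed
    also have "\<dots> = (\<Sum>k\<in>{r<..n}. (fact n)\<^sup>2 * (of_nat k * of_real (component_rate k) * u (n - k)))"
    proof (intro sum.cong refl)
      fix k assume k: "k \<in> {r<..n}"
      have "of_nat (k * (n choose k)\<^sup>2) * h k = ((of_nat (n choose k))\<^sup>2 * ((fact k)\<^sup>2 * (fact (n - k))\<^sup>2))
          * (of_nat k * of_real (component_rate k) * u (n - k))"
        by (simp add: h_def)
      also have "(of_nat (n choose k))\<^sup>2 * ((fact k)\<^sup>2 * (fact (n - k))\<^sup>2) = ((fact n)\<^sup>2 :: 'a)"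
        using k by (intro choose_fact_squares) simp
      finally show "of_nat (k * (n choose k)\<^sup>2) * h k = (fact n)\<^sup>2 * (of_nat k * of_real (component_rate k) * u (n - k))" .
    qed
    also have "\<dots> = of_nat n * ((fact n)\<^sup>2 * u n)"
      using rec[of n] False by (simp add: sum_distrib_left[symmetric])
    finally show ?thesis using False by simp
  qed
qed

section \<open>Coefficient asymptotics\<close>

text \<open>
  The coefficients of \<open>(1 - x) powr (- 1 / 2)\<close>.
\<close>

definition half_binomial :: "nat \<Rightarrow> real" where
  "half_binomial n = pochhammer (1 / 2) n / fact n"

lemma half_binomial_0 [simp]: "half_binomial 0 = 1"
  by (simp add: half_binomial_def)

lemma half_binomial_pos [simp]: "half_binomial n > 0"
  by (simp add: half_binomial_def pochhammer_pos)

lemma half_binomial_nonzero [simp]: "half_binomial n \<noteq> 0"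
  using less_imp_neq[OF half_binomial_pos] by metis

lemma half_binomial_Suc: "half_binomial (Suc n) * (real n + 1) = half_binomial n * (real n + 1 / 2)"
proof -
  have "half_binomial (Suc n) * (real n + 1)
      = pochhammer (1 / 2) n * (1 / 2 + real n) / ((real n + 1) * fact n) * (real n + 1)"
    by (simp add: half_binomial_def pochhammer_Suc add.commute)
  also have "\<dots> = pochhammer (1 / 2) n * (1 / 2 + real n) / fact n"
    by (simp add: add_nonneg_eq_0_iff)
  finally show ?thesis by (simp add: half_binomial_def add.commute)
qed

lemma half_binomial_ratio_Suc:
  "half_binomial n / half_binomial (Suc n) = (real n + 1) / (real n + 1 / 2)"
proof -
  have "real n \<ge> 0" by simp
  then have "real n + 1 / 2 \<noteq> 0" by linarith
  then have "half_binomial n = half_binomial (Suc n) * (real n + 1) / (real n + 1 / 2)"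
    unfolding half_binomial_Suc by (rule nonzero_mult_div_cancel_right[symmetric])
  then show ?thesis by (metis half_binomial_nonzero nonzero_mult_div_cancel_left times_divide_eq_right)
qed

lemma half_binomial_ratio_le: "half_binomial n / half_binomial (n + k) \<le> 2 ^ k"
proof (induction k)
  case (Suc k)
  have "half_binomial n / half_binomial (n + Suc k)
      = half_binomial n / half_binomial (n + k) * (half_binomial (n + k) / half_binomial (Suc (n + k)))"
    by simp
  also have "\<dots> \<le> 2 ^ k * 2"
  proof (intro mult_mono Suc.IH)
    show "half_binomial (n + k) / half_binomial (Suc (n + k)) \<le> 2"
      unfolding half_binomial_ratio_Suc by (simp add: field_simps)
  qed (simp_all add: less_imp_le)
  finally show ?case by simp
qed (use half_binomial_pos[of n] in simp)

lemma half_binomial_ratio_tendsto: "(\<lambda>n. half_binomial (n - k) / half_binomial n) \<longlonglongrightarrow> 1"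
proof -
  have "(\<lambda>n. half_binomial n / half_binomial (n + k)) \<longlonglongrightarrow> 1"
  proof (induction k)
    case 0
    then show ?case using half_binomial_pos by (simp add: less_imp_neq[THEN not_sym])
  next
    case (Suc k)
    have "(\<lambda>n. (real n + 1) / (real n + 1 / 2)) \<longlonglongrightarrow> 1" by real_asymp
    from LIMSEQ_ignore_initial_segment[OF this, of k]
    have "(\<lambda>n. half_binomial (n + k) / half_binomial (Suc (n + k))) \<longlonglongrightarrow> 1"
      unfolding half_binomial_ratio_Suc .
    from tendsto_mult[OF Suc this] show ?case
      using half_binomial_pos by (simp add: less_imp_neq[THEN not_sym])
  qed
  then show ?thesis
    using LIMSEQ_offset[of "\<lambda>n. half_binomial (n - k) / half_binomial n" k 1] by simp
qed

text \<open>
  Multiplying \<open>(1 - x) powr (- 1 / 2)\<close> by a series that converges beyond the singularity at \<open>1\<close> changes the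
  coefficients asymptotically by the value of that series at \<open>1\<close>. The bound \<open>2 ^ k\<close> on the
  coefficient ratios is generous, but the factors of interest are entire, so it makes dominated convergence applicable.
\<close>

lemma convolution_half_binomial_asymptotics:
  fixes g :: "nat \<Rightarrow> complex"
  assumes sum: "summable (\<lambda>k. norm (g k) * 2 ^ k)"
  shows "(\<lambda>n. (\<Sum>k\<le>n. g k * of_real (half_binomial (n - k))) / of_real (half_binomial n)) \<longlonglongrightarrow> suminf g"
proof -
  define a where "a = (\<lambda>k n. if k \<le> n then g k * of_real (half_binomial (n - k) / half_binomial n) else 0)"
  have lim: "(\<lambda>n. a k n) \<longlonglongrightarrow> g k" for k
  proof -
    have "(\<lambda>n. g k * of_real (half_binomial (n - k) / half_binomial n)) \<longlonglongrightarrow> g k * of_real 1"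
      by (intro tendsto_intros half_binomial_ratio_tendsto)
    moreover have "eventually (\<lambda>n. g k * of_real (half_binomial (n - k) / half_binomial n) = a k n) sequentially"
      using eventually_ge_at_top[of k] by eventually_elim (simp add: a_def)
    ultimately show ?thesis by (simp add: Lim_transform_eventually)
  qed
  have bound: "norm (a k n) \<le> norm (g k) * 2 ^ k" for k n
  proof (cases "k \<le> n")
    case True
    have "norm (a k n) = norm (g k) * (half_binomial (n - k) / half_binomial n)"
      using True by (simp add: a_def norm_mult norm_divide abs_of_pos)
    also have "\<dots> \<le> norm (g k) * 2 ^ k"
      using half_binomial_ratio_le[of "n - k" k] True by (intro mult_left_mono) auto
    finally show ?thesis .
  qed (simp add: a_def)
  have "(\<lambda>n. suminf (\<lambda>k. a k n)) \<longlonglongrightarrow> suminf g"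
    using tannerys_theorem[OF lim _ sum] bound by (simp add: case_prod_unfold)
  moreover have "suminf (\<lambda>k. a k n)
      = (\<Sum>k\<le>n. g k * of_real (half_binomial (n - k))) / of_real (half_binomial n)" for n
  proof -
    have "suminf (\<lambda>k. a k n) = (\<Sum>k\<le>n. a k n)"
      by (intro suminf_finite) (auto simp: a_def)
    also have "\<dots> = (\<Sum>k\<le>n. g k * of_real (half_binomial (n - k)) / of_real (half_binomial n))"
      by (intro sum.cong) (auto simp: a_def)
    finally show ?thesis by (simp add: sum_divide_distrib)
  qed
  ultimately show ?thesis by simp
qed

definition exp_poly_fps :: "complex poly \<Rightarrow> complex fps" where
  "exp_poly_fps Q = fps_expansion (\<lambda>z. exp (poly Q z)) 0"

definition half_binomial_fps :: "complex fps" where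
  "half_binomial_fps = Abs_fps (\<lambda>n. of_real (half_binomial n))"

text \<open>
  Taking the Taylor series of the entire function, rather than composing formal series, provides the
  infinite radius of convergence directly.
\<close>

lemma exp_poly_has_fps_expansion: "(\<lambda>z. exp (poly Q z)) has_fps_expansion exp_poly_fps Q"
  unfolding exp_poly_fps_def
  by (rule has_fps_expansion_fps_expansion[of UNIV]) (auto intro!: holomorphic_intros)

lemma fps_conv_radius_exp_poly: "fps_conv_radius (exp_poly_fps Q) = \<infinity>"
proof -
  have "fps_conv_radius (exp_poly_fps Q) \<ge> \<infinity>"
    unfolding exp_poly_fps_def
    by (rule conv_radius_fps_expansion) (auto intro!: holomorphic_intros)
  then show ?thesis by simp
qed

lemma fps_deriv_exp_poly: "fps_deriv (exp_poly_fps Q) = exp_poly_fps Q * fps_of_poly (pderiv Q)"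
proof (rule fps_expansion_unique_complex)
  have *: "deriv (\<lambda>z. exp (poly Q z)) = (\<lambda>z. exp (poly Q z) * poly (pderiv Q) z)"
    by (intro ext DERIV_imp_deriv) (auto intro!: derivative_eq_intros)
  show "(\<lambda>z. exp (poly Q z) * poly (pderiv Q) z) has_fps_expansion fps_deriv (exp_poly_fps Q)"
    using has_fps_expansion_deriv[OF exp_poly_has_fps_expansion[of Q]] by (simp add: *)
  have "poly (pderiv Q) has_fps_expansion fps_of_poly (pderiv Q)"
    by (simp add: has_fps_expansion_def)
  then show "(\<lambda>z. exp (poly Q z) * poly (pderiv Q) z) has_fps_expansion exp_poly_fps Q * fps_of_poly (pderiv Q)"
    by (intro has_fps_expansion_mult exp_poly_has_fps_expansion) simp
qed

lemma exp_poly_fps_nth_0: "fps_nth (exp_poly_fps Q) 0 = exp (poly Q 0)"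
  by (simp add: exp_poly_fps_def fps_expansion_def)

lemma exp_poly_fps_sum:
  "summable (\<lambda>k. norm (fps_nth (exp_poly_fps Q) k) * 2 ^ k)"
  "suminf (fps_nth (exp_poly_fps Q)) = exp (poly Q 1)"
proof -
  have "summable (\<lambda>k. norm (fps_nth (exp_poly_fps Q) k * 2 ^ k))"
    by (rule abs_summable_in_conv_radius)
      (use fps_conv_radius_exp_poly[of Q] in \<open>simp add: fps_conv_radius_def\<close>)
  then show "summable (\<lambda>k. norm (fps_nth (exp_poly_fps Q) k) * 2 ^ k)"
    by (simp add: norm_mult norm_power)
  have "(\<lambda>k. fps_nth (exp_poly_fps Q) k * 1 ^ k) sums exp (poly Q 1)"
    by (rule has_fps_expansion_imp_sums_complex[OF exp_poly_has_fps_expansion, of _ \<infinity>])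
      (auto intro!: holomorphic_intros)
  then show "suminf (fps_nth (exp_poly_fps Q)) = exp (poly Q 1)"
    by (simp add: sums_iff)
qed

lemma fps_deriv_half_binomial:
  "fps_deriv half_binomial_fps = half_binomial_fps * Abs_fps (\<lambda>_. 1 / 2)"
proof -
  let ?B = half_binomial_fps
  have "(1 - fps_X) * fps_deriv ?B = fps_const (1 / 2) * ?B"
  proof (rule fps_ext)
    fix n
    have "of_real (half_binomial (Suc n) * (real n + 1)) = (of_real (half_binomial n * (real n + 1 / 2)) :: complex)"
      by (simp only: half_binomial_Suc)
    then show "fps_nth ((1 - fps_X) * fps_deriv ?B) n = fps_nth (fps_const (1 / 2) * ?B) n"
      by (cases n) (simp_all add: half_binomial_fps_def algebra_simps)
  qed
  moreover have geom: "Abs_fps (\<lambda>_. 1) * (1 - fps_X) = (1 :: complex fps)"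
    by (rule fps_ext) (simp add: algebra_simps)
  ultimately have "fps_deriv ?B = Abs_fps (\<lambda>_. 1) * (fps_const (1 / 2) * ?B)"
    by (metis mult.assoc mult.left_neutral)
  also have "\<dots> = ?B * (fps_const (1 / 2) * Abs_fps (\<lambda>_. 1))" by (simp only: mult_ac)
  also have "fps_const (1 / 2) * Abs_fps (\<lambda>_. 1) = Abs_fps (\<lambda>_. 1 / 2 :: complex)"
    by (rule fps_ext) simp
  finally show ?thesis .
qed

text \<open>
  The series of \<open>exp (Q x) / sqrt (1 - x)\<close>.
\<close>

definition exp_over_sqrt_fps :: "complex poly \<Rightarrow> complex fps" where
  "exp_over_sqrt_fps Q = exp_poly_fps Q * half_binomial_fps"

text \<open>
  Logarithmic differentiation: the derivative of \<open>Q x - ln (1 - x) / 2\<close> has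
  the coefficients \<open>1 / 2 + coeff (pderiv Q) i\<close>.
\<close>

lemma exp_over_sqrt_fps_recurrence:
  assumes "n \<ge> 1"
  shows "of_nat n * fps_nth (exp_over_sqrt_fps Q) n
    = (\<Sum>k=1..n. (1 / 2 + coeff (pderiv Q) (k - 1)) * fps_nth (exp_over_sqrt_fps Q) (n - k))"
proof -
  obtain m where n: "n = Suc m" using assms by (cases n) auto
  define P where "P = Abs_fps (\<lambda>i. 1 / 2 + coeff (pderiv Q) i)"
  have P: "P = Abs_fps (\<lambda>_. 1 / 2) + fps_of_poly (pderiv Q)"
    by (rule fps_ext) (simp add: P_def)
  have "fps_deriv (exp_over_sqrt_fps Q) = P * exp_over_sqrt_fps Q"
    unfolding exp_over_sqrt_fps_def P by (simp add: fps_deriv_exp_poly fps_deriv_half_binomial algebra_simps)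
  then have "fps_nth (fps_deriv (exp_over_sqrt_fps Q)) m = fps_nth (P * exp_over_sqrt_fps Q) m" by simp
  then have "of_nat n * fps_nth (exp_over_sqrt_fps Q) n = (\<Sum>i=0..m. fps_nth P i * fps_nth (exp_over_sqrt_fps Q) (m - i))"
    by (simp add: n fps_mult_nth)
  also have "\<dots> = (\<Sum>k=1..n. fps_nth P (k - 1) * fps_nth (exp_over_sqrt_fps Q) (n - k))"
    unfolding n by (rule sum.reindex_bij_witness[of _ "\<lambda>k. k - 1" Suc]) auto
  finally show ?thesis by (simp add: P_def)
qed

lemma exp_over_sqrt_fps_asymptotics:
  "(\<lambda>n. fps_nth (exp_over_sqrt_fps Q) n / of_real (half_binomial n)) \<longlonglongrightarrow> exp (poly Q 1)"
proof -
  have "fps_nth (exp_over_sqrt_fps Q) n = (\<Sum>k\<le>n. fps_nth (exp_poly_fps Q) k * of_real (half_binomial (n - k)))" for n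
    by (simp add: exp_over_sqrt_fps_def half_binomial_fps_def fps_mult_nth atLeast0AtMost)
  then show ?thesis
    using convolution_half_binomial_asymptotics[OF exp_poly_fps_sum(1)[of Q]]
    by (simp add: exp_poly_fps_sum(2))
qed

text \<open>
  The difference between \<open>\<Sum>k>r. component_rate k * x ^ k\<close> and \<open>- ln (1 - x) / 2 = (\<Sum>k\<ge>1. x ^ k / (2 * k))\<close>. For
  \<open>r = 0\<close> only the exceptional rate at \<open>k = 1\<close> contributes; for \<open>r \<ge> 1\<close> that rate is excluded from the sum and the
  difference consists of the missing terms with \<open>k \<le> r\<close>.
\<close>

definition correction_poly :: "nat \<Rightarrow> complex poly" where
  "correction_poly r = (if r = 0 then [:0, 1 / 2:] else (\<Sum>k=1..r. monom (- 1 / (2 * of_nat k)) k))"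

lemma coeff_pderiv_correction_poly:
  "1 / 2 + coeff (pderiv (correction_poly r)) i
     = (if r < Suc i then of_nat (Suc i) * of_real (component_rate (Suc i)) else 0)"
proof (cases "r = 0")
  case True
  then show ?thesis
    by (cases i) (simp_all add: correction_poly_def component_rate_def pderiv_pCons field_simps del: of_nat_Suc)
next
  case False
  have "coeff (pderiv (correction_poly r)) i = of_nat (Suc i) * coeff (correction_poly r) (Suc i)"
    by (simp add: coeff_pderiv)
  also have "coeff (correction_poly r) (Suc i) = (if Suc i \<le> r then - 1 / (2 * of_nat (Suc i)) else 0)"
    using False by (simp add: correction_poly_def coeff_sum del: of_nat_Suc)
  finally show ?thesis
    using False by (auto simp: component_rate_def field_simps simp del: of_nat_Suc)
qed

lemma poly_correction_poly_1:
  "poly (correction_poly r) 1 = of_real (if r = 0 then 1 / 2 else - harm r / 2)"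
  by (auto simp: correction_poly_def poly_sum poly_monom harm_def sum_divide_distrib sum_negf
      divide_simps intro!: sum.cong)

lemma card_large2_asymptotics:
  "(\<lambda>n. real (card (large2 r {1..n} {1..n})) / ((fact n)\<^sup>2 * half_binomial n))
     \<longlonglongrightarrow> exp (if r = 0 then 1 / 2 else - harm r / 2)"
proof -
  define u where "u = fps_nth (exp_over_sqrt_fps (correction_poly r))"
  have "poly (correction_poly r) 0 = 0"
    by (auto simp: correction_poly_def poly_sum poly_monom intro!: sum.neutral)
  then have u0: "u 0 = 1"
    by (simp add: u_def exp_over_sqrt_fps_def exp_poly_fps_nth_0 half_binomial_fps_def)
  have rec: "of_nat n * u n = (\<Sum>k\<in>{r<..n}. of_nat k * of_real (component_rate k) * u (n - k))" if "n \<ge> 1" for n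
  proof -
    have "of_nat n * u n = (\<Sum>k=1..n. (1 / 2 + coeff (pderiv (correction_poly r)) (k - 1)) * u (n - k))"
      unfolding u_def by (rule exp_over_sqrt_fps_recurrence[OF that])
    also have "\<dots> = (\<Sum>k=1..n. if k \<in> {r<..n} then of_nat k * of_real (component_rate k) * u (n - k) else 0)"
    proof (intro sum.cong refl)
      fix k assume "k \<in> {1..n}"
      then obtain i where "k = Suc i" "k \<le> n" by (cases k) auto
      then show "(1 / 2 + coeff (pderiv (correction_poly r)) (k - 1)) * u (n - k)
          = (if k \<in> {r<..n} then of_nat k * of_real (component_rate k) * u (n - k) else 0)"
        by (simp add: coeff_pderiv_correction_poly del: of_nat_Suc)
    qed
    also have "\<dots> = (\<Sum>k\<in>{1..n} \<inter> {r<..n}. of_nat k * of_real (component_rate k) * u (n - k))"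
      by (simp add: sum.inter_restrict)
    also have "{1..n} \<inter> {r<..n} = {r<..n}" by auto
    finally show ?thesis .
  qed
  have "of_nat (card (large2 r {1..n} {1..n})) = (fact n)\<^sup>2 * u n" for n
    by (rule card_large2[OF u0 rec]) auto
  then have "(\<lambda>n. (of_nat (card (large2 r {1..n} {1..n})) / (fact n)\<^sup>2) / of_real (half_binomial n))
      \<longlonglongrightarrow> exp (poly (correction_poly r) 1)"
    using exp_over_sqrt_fps_asymptotics[of "correction_poly r"] by (simp add: u_def)
  then have "(\<lambda>n. complex_of_real (real (card (large2 r {1..n} {1..n})) / ((fact n)\<^sup>2 * half_binomial n)))
      \<longlonglongrightarrow> complex_of_real (exp (if r = 0 then 1 / 2 else - harm r / 2))"
    unfolding poly_correction_poly_1 exp_of_real by simp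
  then show ?thesis by (simp only: tendsto_of_real_iff)
qed

section \<open>The smallest component and its limit law\<close>

lemma matrices2_eq_regular: "matrices2 n = regular 2 {1..n} {1..n}"
  by (simp add: matrices2_def regular_def)

text \<open>
  If the block on \<open>U \<times> V\<close> already exhausts the line sums \<open>2\<close>, then no entry outside the block in its
  rows or columns can be nonzero. Conversely, equality of the two cardinalities comes from counting
  the entries of the block by rows and by columns.
\<close>

lemma is_k_component_iff_component:
  assumes A: "A \<in> matrices2 n"
  shows "is_k_component n A k (U, V) \<longleftrightarrow> component {1..n} {1..n} A U V \<and> card U = k"
proof
  have A': "A \<in> regular 2 {1..n} {1..n}" using A by (simp add: matrices2_eq_regular)
  let ?N = "{1..n}"
  {
    assume "is_k_component n A k (U, V)"
    then have U: "U \<noteq> {}" "U \<subseteq> ?N" "V \<subseteq> ?N" "card U = k"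
      and row: "\<And>i. i \<in> U \<Longrightarrow> (\<Sum>j\<in>V. A i j) = 2" and col: "\<And>j. j \<in> V \<Longrightarrow> (\<Sum>i\<in>U. A i j) = 2"
      by (auto simp: is_k_component_def)
    have "closed_pair A U V"
      unfolding closed_pair_def
    proof (intro allI impI iffI)
      fix i j assume nz: "A i j \<noteq> 0"
      then have ij: "i \<in> ?N" "j \<in> ?N" using regular_pos[OF A', of i j] by auto
      show "j \<in> V" if i: "i \<in> U"
      proof (rule ccontr)
        assume j: "j \<notin> V"
        have "A i j + (\<Sum>j\<in>V. A i j) = (\<Sum>j\<in>insert j V. A i j)"
          using j U by (simp add: finite_subset[OF U(3)])
        also have "\<dots> \<le> (\<Sum>j\<in>?N. A i j)" using ij U by (intro sum_mono2) auto
        finally show False using nz row[OF i] regular_row[OF A' ij(1)] by simp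
      qed
      show "i \<in> U" if j: "j \<in> V"
      proof (rule ccontr)
        assume i: "i \<notin> U"
        have "A i j + (\<Sum>i\<in>U. A i j) = (\<Sum>i\<in>insert i U. A i j)"
          using i U by (simp add: finite_subset[OF U(2)])
        also have "\<dots> \<le> (\<Sum>i\<in>?N. A i j)" using ij U by (intro sum_mono2) auto
        finally show False using nz col[OF j] regular_col[OF A' ij(2)] by simp
      qed
    qed
    with U show "component ?N ?N A U V \<and> card U = k" by (simp add: component_def)
  }
  {
    assume "component ?N ?N A U V \<and> card U = k"
    then have U: "U \<noteq> {}" "U \<subseteq> ?N" "V \<subseteq> ?N" "card U = k" and cl: "closed_pair A U V"
      by (auto simp: component_def)
    have R: "restrict_mat A U V \<in> regular 2 U V"
      using restrict_mat_regular[OF A' cl U(2,3)] by simp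
    have "card V = k" using regular_card_eq[OF R] U by simp
    moreover have "finite U" using U by (auto intro: finite_subset)
    ultimately have "V \<noteq> {}" using U by auto
    moreover have "(\<Sum>j\<in>V. A i j) = 2" if "i \<in> U" for i
      using regular_row[OF R that] that by (simp add: restrict_mat_def)
    moreover have "(\<Sum>i\<in>U. A i j) = 2" if "j \<in> V" for j
      using regular_col[OF R that] that by (simp add: restrict_mat_def)
    ultimately show "is_k_component n A k (U, V)"
      using U \<open>card V = k\<close> by (simp add: is_k_component_def)
  }
qed

lemma is_component_iff_component:
  assumes "A \<in> matrices2 n"
  shows "is_component n A (U, V) \<longleftrightarrow> component {1..n} {1..n} A U V"
  using is_k_component_iff_component[OF assms] by (auto simp: is_component_def)

lemma num_irreducible_pos_iff:
  "num_irreducible n k A > 0 \<longleftrightarrow> (\<exists>C. irreducible_k_component n A k C)"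
proof -
  have "finite {C. irreducible_k_component n A k C}"
    by (rule finite_subset[of _ "Pow {1..n} \<times> Pow {1..n}"])
       (auto simp: irreducible_k_component_def is_k_component_def)
  then show ?thesis by (auto simp: num_irreducible_def card_gt_0_iff)
qed

text \<open>
  A component with the fewest rows is irreducible.
\<close>

lemma ex_irreducible_le:
  assumes A: "A \<in> matrices2 n" and C: "component {1..n} {1..n} A U V"
  shows "\<exists>k\<ge>1. k \<le> card U \<and> num_irreducible n k A > 0"
proof -
  define P where "P = (\<lambda>(U, V). component {1..n} {1..n} A U V)"
  have "P (U, V)" using C by (simp add: P_def)
  from ex_has_least_nat[of P, OF this, of "\<lambda>(U, V). card U"]
  obtain X Y where XY: "component {1..n} {1..n} A X Y"
    and least: "\<And>X' Y'. component {1..n} {1..n} A X' Y' \<Longrightarrow> card X \<le> card X'"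
    by (auto simp: P_def)
  have k: "is_k_component n A (card X) (X, Y)"
    using XY by (simp add: is_k_component_iff_component[OF A])
  have fin: "finite X" "finite Y"
    using XY by (auto simp: component_def intro: finite_subset)
  have "irreducible_k_component n A (card X) (X, Y)"
    unfolding irreducible_k_component_def
  proof (intro conjI k notI)
    assume "\<exists>C'. is_component n A C' \<and> C' \<noteq> (X, Y) \<and> fst C' \<subseteq> fst (X, Y) \<and> snd C' \<subseteq> snd (X, Y)"
    then obtain X' Y' where C': "is_component n A (X', Y')" "(X', Y') \<noteq> (X, Y)" "X' \<subseteq> X" "Y' \<subseteq> Y"
      by auto
    have comp': "component {1..n} {1..n} A X' Y'"
      using C'(1) by (simp add: is_component_iff_component[OF A])
    have "X' = X" using card_seteq[OF fin(1) C'(3)] least[OF comp'] by simp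
    moreover have "is_k_component n A (card X') (X', Y')"
      using comp' by (simp add: is_k_component_iff_component[OF A])
    ultimately have "card Y' = card Y" using k by (simp add: is_k_component_def)
    then have "Y' = Y" using C'(4) fin by (simp add: card_subset_eq)
    with C'(2) \<open>X' = X\<close> show False by simp
  qed
  then have "num_irreducible n (card X) A > 0" by (auto simp: num_irreducible_pos_iff)
  moreover have "card X \<ge> 1"
    using XY fin by (simp add: component_def Suc_le_eq card_gt_0_iff)
  ultimately show ?thesis using least[OF C] by blast
qed

text \<open>
  This replaces the infimum over irreducible components by a condition on all components, which
  is the one that was counted.
\<close>

lemma smallest_component_gt_iff:
  assumes n: "n \<ge> 1" and A: "A \<in> matrices2 n"
  shows "r < smallest_component n A \<longleftrightarrow> A \<in> large2 r {1..n} {1..n}"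
proof
  let ?K = "{k. k \<ge> 1 \<and> num_irreducible n k A > 0}"
  {
    assume r: "r < smallest_component n A"
    have "r < card U" if C: "component {1..n} {1..n} A U V" for U V
    proof -
      obtain k where "k \<in> ?K" "k \<le> card U" using ex_irreducible_le[OF A C] by auto
      moreover have "smallest_component n A \<le> k"
        unfolding smallest_component_def using \<open>k \<in> ?K\<close> by (intro cInf_lower) auto
      ultimately show ?thesis using r by simp
    qed
    then show "A \<in> large2 r {1..n} {1..n}"
      using A unfolding large2_def matrices2_eq_regular by blast
  }
  {
    assume L: "A \<in> large2 r {1..n} {1..n}"
    have "?K \<noteq> {}" using ex_irreducible[OF n A] by blast
    then have "smallest_component n A \<in> ?K"
      unfolding smallest_component_def by (rule Inf_nat_def1)
    then obtain U V where "irreducible_k_component n A (smallest_component n A) (U, V)"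
      by (auto simp: num_irreducible_pos_iff)
    then have "component {1..n} {1..n} A U V" "card U = smallest_component n A"
      using is_k_component_iff_component[OF A] by (auto simp: irreducible_k_component_def)
    then show "r < smallest_component n A" using L by (auto simp: large2_def)
  }
qed

text \<open>
  The probability that the limit exceeds \<open>r\<close>. The case \<open>r = 0\<close> is separate because the double edges,
  whose rate is \<open>1\<close> rather than \<open>1 / 2\<close>, are excluded only when \<open>r \<ge> 1\<close>.
\<close>

definition limit_tail :: "nat \<Rightarrow> real" where
  "limit_tail r = (if r = 0 then 1 else exp (- 1 / 2 - harm r / 2))"

lemma limit_tail_tendsto_0: "limit_tail \<longlonglongrightarrow> 0"
proof -
  have "LIM r sequentially. 1 / 2 + 1 / 2 * (harm r :: real) :> at_top"
    by (intro filterlim_tendsto_add_at_top[OF tendsto_const]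
        filterlim_tendsto_pos_mult_at_top[OF tendsto_const _ harm_at_top]) simp
  then have "LIM r sequentially. - (1 / 2 + 1 / 2 * (harm r :: real)) :> at_bot"
    by (simp only: filterlim_uminus_at_bot minus_minus)
  then have "(\<lambda>r. exp (- (1 / 2 + 1 / 2 * harm r :: real))) \<longlonglongrightarrow> 0"
    by (rule filterlim_compose[OF exp_at_bot])
  then show ?thesis
    by (rule Lim_transform_eventually)
      (use eventually_gt_at_top[of 0] in eventually_elim, simp add: limit_tail_def)
qed

lemma limit_tail_antimono: "limit_tail (Suc r) \<le> limit_tail r"
  by (simp add: limit_tail_def harm_Suc) (simp add: harm_def)

text \<open>
  Both the favourable and the total number of matrices are asymptotic to a constant times
  \<open>(n!)\<^sup>2 * half_binomial n\<close>, and only the quotient of the two constants survives.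
\<close>

lemma prob_smallest_component_gt_tendsto:
  "(\<lambda>n. measure_pmf.prob (pmf_of_set (matrices2 n)) {A. r < smallest_component n A}) \<longlonglongrightarrow> limit_tail r"
proof -
  let ?L = "\<lambda>r n. real (card (large2 r {1..n} {1..n})) / ((fact n)\<^sup>2 * half_binomial n)"
  have "(\<lambda>n. ?L r n / ?L 0 n) \<longlonglongrightarrow> exp (if r = 0 then 1 / 2 else - harm r / 2) / exp (1 / 2)"
    using card_large2_asymptotics[of 0] by (intro tendsto_divide card_large2_asymptotics) auto
  also have "exp (if r = 0 then 1 / 2 else - harm r / 2) / exp (1 / 2) = limit_tail r"
    by (simp add: limit_tail_def flip: exp_diff)
  finally have "(\<lambda>n. ?L r n / ?L 0 n) \<longlonglongrightarrow> limit_tail r" .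
  moreover have "eventually (\<lambda>n. ?L r n / ?L 0 n
      = measure_pmf.prob (pmf_of_set (matrices2 n)) {A. r < smallest_component n A}) sequentially"
    using eventually_ge_at_top[of 1]
  proof eventually_elim
    case (elim n)
    have eq0: "matrices2 n = large2 0 {1..n} {1..n}"
      by (simp add: matrices2_eq_regular large2_0)
    have "large2 r {1..n} {1..n} \<subseteq> matrices2 n" by (auto simp: large2_def matrices2_eq_regular)
    then have eqr: "matrices2 n \<inter> {A. r < smallest_component n A} = large2 r {1..n} {1..n}"
      using smallest_component_gt_iff[OF elim] by blast
    have "measure_pmf.prob (pmf_of_set (matrices2 n)) {A. r < smallest_component n A}
        = real (card (large2 r {1..n} {1..n})) / real (card (large2 0 {1..n} {1..n}))"
      unfolding measure_pmf_of_set[OF matrices2_nonempty finite_matrices2] eqr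
      by (simp only: eq0)
    then show ?case by simp
  qed
  ultimately show ?thesis by (rule Lim_transform_eventually)
qed

definition limit_mass :: "nat \<Rightarrow> real" where
  "limit_mass r = (if r = 0 then 0 else limit_tail (r - 1) - limit_tail r)"

lemma limit_mass_nonneg: "limit_mass r \<ge> 0"
  using limit_tail_antimono by (cases r) (simp_all add: limit_mass_def)

lemma sum_limit_mass: "(\<Sum>k\<le>r. limit_mass k) = 1 - limit_tail r"
  by (induction r) (auto simp: limit_mass_def limit_tail_def)

definition limit_pmf :: "nat pmf" where
  "limit_pmf = embed_pmf limit_mass"

lemma pmf_limit_pmf: "pmf limit_pmf r = limit_mass r"
proof -
  have "(\<lambda>n. \<Sum>k\<le>n. limit_mass k) \<longlonglongrightarrow> 1"
    unfolding sum_limit_mass using tendsto_diff[OF tendsto_const[of 1] limit_tail_tendsto_0] by simp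
  then have "limit_mass sums 1" by (simp add: sums_def_le)
  then have "(\<integral>\<^sup>+ r. ennreal (limit_mass r) \<partial>count_space UNIV) = 1"
    by (simp add: nn_integral_count_space_nat suminf_ennreal2 limit_mass_nonneg sums_iff)
  then show ?thesis
    unfolding limit_pmf_def by (intro pmf_embed_pmf limit_mass_nonneg)
qed

lemma pmf_limit_pmf_explicit:
  assumes "r \<ge> 1"
  shows "pmf limit_pmf r =
     (if r = 1 then 1 - exp (- 1)
      else exp (- 1 / 2 - (harm (r - 1) :: real) / 2) * (1 - exp (- 1 / (2 * real r))))"
proof (cases "r = 1")
  case True
  then show ?thesis by (simp add: pmf_limit_pmf limit_mass_def limit_tail_def harm_def)
next
  case False
  then obtain q where q: "r = Suc q" "q \<ge> 1" using assms by (cases r) auto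
  have "- 1 / 2 - harm (Suc q) / 2 = (- 1 / 2 - harm q / 2) + (- 1 / (2 * real (Suc q)))"
    by (simp add: harm_Suc field_simps)
  then have "limit_tail (Suc q) = exp (- 1 / 2 - harm q / 2) * exp (- 1 / (2 * real (Suc q)))"
    unfolding limit_tail_def by (simp only: exp_add if_False nat.distinct)
  then show ?thesis
    using q by (simp add: pmf_limit_pmf limit_mass_def algebra_simps) (simp add: limit_tail_def)
qed

lemma prob_limit_pmf_le: "measure_pmf.prob limit_pmf {..r} = 1 - limit_tail r"
  by (simp add: measure_measure_pmf_finite pmf_limit_pmf sum_limit_mass)

theorem corollary2p5:
  shows "\<exists>S_inf :: nat pmf.
    (\<forall>r\<ge>1. pmf S_inf r =
       (if r = 1 then 1 - exp (- 1)
        else exp (- 1 / 2 - (harm (r - 1) :: real) / 2) * (1 - exp (- 1 / (2 * real r))))) \<and>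
    weak_conv_m
      (\<lambda>n. distr (measure_pmf (pmf_of_set (matrices2 n))) borel
              (\<lambda>A. real (smallest_component n A)))
      (distr (measure_pmf S_inf) borel real)"
proof (intro exI[of _ limit_pmf] conjI allI impI)
  show "weak_conv_m
      (\<lambda>n. distr (measure_pmf (pmf_of_set (matrices2 n))) borel (\<lambda>A. real (smallest_component n A)))
      (distr (measure_pmf limit_pmf) borel real)"
    unfolding weak_conv_m_def weak_conv_def
  proof (intro allI impI)
    fix x :: real
    let ?P = "\<lambda>n. measure_pmf.prob (pmf_of_set (matrices2 n))"
    have cdfs: "cdf (distr (measure_pmf (pmf_of_set (matrices2 n))) borel (\<lambda>A. real (smallest_component n A))) x
        = ?P n {A. real (smallest_component n A) \<le> x}" for n
      by (simp add: cdf_def measure_distr vimage_def)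
    have cdf_lim: "cdf (distr (measure_pmf limit_pmf) borel real) x = measure_pmf.prob limit_pmf {k. real k \<le> x}"
      by (simp add: cdf_def measure_distr vimage_def)
    show "(\<lambda>n. cdf (distr (measure_pmf (pmf_of_set (matrices2 n))) borel (\<lambda>A. real (smallest_component n A))) x)
        \<longlonglongrightarrow> cdf (distr (measure_pmf limit_pmf) borel real) x"
    proof (cases "x < 0")
      case True
      then have "\<not> real k \<le> x" for k by (simp add: not_le less_le_trans)
      then show ?thesis unfolding cdfs cdf_lim by simp
    next
      case False
      define r where "r = nat \<lfloor>x\<rfloor>"
      have le: "real k \<le> x \<longleftrightarrow> k \<le> r" for k
        using False unfolding r_def by (simp add: le_nat_iff le_floor_iff)
      have "?P n {A. real (smallest_component n A) \<le> x} = 1 - ?P n {A. r < smallest_component n A}" for n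
        using measure_pmf.prob_compl[of "{A. r < smallest_component n A}" "pmf_of_set (matrices2 n)"]
        by (simp add: le Compl_eq_Diff_UNIV[symmetric] Collect_neg_eq[symmetric] not_less)
      then have "(\<lambda>n. ?P n {A. real (smallest_component n A) \<le> x}) \<longlonglongrightarrow> 1 - limit_tail r"
        using tendsto_diff[OF tendsto_const prob_smallest_component_gt_tendsto[of r]] by simp
      moreover have "measure_pmf.prob limit_pmf {k. real k \<le> x} = 1 - limit_tail r"
        using prob_limit_pmf_le[of r] by (simp add: le atMost_def)
      ultimately show ?thesis unfolding cdfs cdf_lim by simp
    qed
  qed
qed (rule pmf_limit_pmf_explicit)

end
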